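(* For any $n\geq1$ and any $a\in\mathbb Z$, the category ${}^{\rm b}(\mathcal D^E,\mathcal H)^a_{0}$-mod is wild.
   Context: Ground field $\mathbb C$. $\mathcal D=\mathcal D(n+1)$ is the Weyl algebra of differential operators on $\mathbb C[t_0,\dots,t_n]$, $\mathcal H=\mathbb C[t_0\partial_0,\dots,t_n\partial_n]$, $E=\sum_i t_i\partial_i$, $\mathcal D^E$ the centralizer of $E$ in $\mathcal D$. A generalized weight $(\mathcal D^E,\mathcal H)$-module is a $\mathcal D^E$-module $M=\bigoplus_{\lambda\in\mathbb C^{n+1}}M^{(\lambda)}$, $M^{(\lambda)}=\{m:(t_i\partial_i-\lambda_i)^Nm=0\text{ for some }N>0\text{ and all }i\}$. ${}^{\rm b}(\mathcal D^E,\mathcal H)^a_0$-mod is the category of such modules with finite-dimensional $M^{(\lambda)}$, with locally nilpotent action of $E-a$, and with support $\{\lambda:M^{(\lambda)}\ne0\}$ in $\mathbb Z^{n+1}$. Wild has the standard meaning: the classification problem for the objects of the category contains the classification of finite-dimensional modules over the free algebra in two generators (pairs of matrices up to simultaneous conjugation). *)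

theory Defs
  imports "HOL-Analysis.Analysis" "HOL-Library.Poly_Mapping"
begin

section \<open>Complex scalar multiplication on finitely supported functions\<close>

lift_definition cscale :: "complex \<Rightarrow> ('k \<Rightarrow>\<^sub>0 complex) \<Rightarrow> ('k \<Rightarrow>\<^sub>0 complex)"
  is "\<lambda>c f k. c * f k"
  by (rule finite_subset[rotated]) auto

interpretation cvs: vector_space cscale
  by unfold_locales (transfer; auto simp: fun_eq_iff algebra_simps)+

definition finite_dimensional :: "('k \<Rightarrow>\<^sub>0 complex) set \<Rightarrow> bool" where
  "finite_dimensional V \<longleftrightarrow> (\<exists>B. finite B \<and> V \<subseteq> cvs.span B)"

definition linear_between ::
  "('k \<Rightarrow>\<^sub>0 complex) set \<Rightarrow> ('l \<Rightarrow>\<^sub>0 complex) set \<Rightarrow> (('k \<Rightarrow>\<^sub>0 complex) \<Rightarrow> ('l \<Rightarrow>\<^sub>0 complex)) \<Rightarrow> bool"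
where
  "linear_between V W f \<longleftrightarrow> f \<in> V \<rightarrow> W
     \<and> (\<forall>x\<in>V. \<forall>y\<in>V. f (x + y) = f x + f y)
     \<and> (\<forall>c. \<forall>x\<in>V. f (cscale c x) = cscale c (f x))"

section \<open>Linear representations and the categories they form\<close>

text \<open>The vector space underlying a representation is a subspace of the space of finitely
  supported functions from \<^typ>\<open>nat\<close> to \<^typ>\<open>complex\<close>. That space has countably infinite
  dimension, so every complex vector space of at most countable dimension is isomorphic to one of
  its subspaces. A finite-dimensional module has finite dimension, and a weight module with
  support in a lattice and finite-dimensional weight spaces has countable dimension; hence the
  categories of representations below are equivalent to the ones over arbitrary vector spaces.\<close>

type_synonym vec = "nat \<Rightarrow>\<^sub>0 complex"

record 'g rep =
  rep_space :: "vec set"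
  rep_act :: "'g \<Rightarrow> vec \<Rightarrow> vec"

text \<open>Below, \<open>L :: 'g set\<close> is the set of those labels that really act. Values of
  \<^const>\<open>rep_act\<close> at other labels, or outside \<^const>\<open>rep_space\<close>, are irrelevant. A category is
  given by \<open>L\<close> and a set of objects; it is the full subcategory on these objects. Morphisms are
  extensional functions, so that equality of morphisms is equality on the underlying space.\<close>

definition rep_hom :: "'g set \<Rightarrow> 'g rep \<Rightarrow> 'g rep \<Rightarrow> (vec \<Rightarrow> vec) set" where
  "rep_hom L M N = {f \<in> rep_space M \<rightarrow>\<^sub>E rep_space N.
     linear_between (rep_space M) (rep_space N) f \<and>
     (\<forall>P\<in>L. \<forall>x\<in>rep_space M. f (rep_act M P x) = rep_act N P (f x))}"

definition rep_isomorphic :: "'g set \<Rightarrow> 'g rep \<Rightarrow> 'g rep \<Rightarrow> bool" where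
  "rep_isomorphic L M N \<longleftrightarrow> (\<exists>f\<in>rep_hom L M N. bij_betw f (rep_space M) (rep_space N))"

definition short_exact ::
  "'g set \<Rightarrow> 'g rep \<Rightarrow> 'g rep \<Rightarrow> 'g rep \<Rightarrow> (vec \<Rightarrow> vec) \<Rightarrow> (vec \<Rightarrow> vec) \<Rightarrow> bool"
where
  "short_exact L X Y Z f g \<longleftrightarrow> f \<in> rep_hom L X Y \<and> g \<in> rep_hom L Y Z
     \<and> inj_on f (rep_space X)
     \<and> f ` rep_space X = {y \<in> rep_space Y. g y = 0}
     \<and> g ` rep_space Y = rep_space Z"

definition subrep :: "'g set \<Rightarrow> vec set \<Rightarrow> 'g rep \<Rightarrow> bool" where
  "subrep L U M \<longleftrightarrow> cvs.subspace U \<and> U \<subseteq> rep_space M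
     \<and> (\<forall>P\<in>L. \<forall>x\<in>U. rep_act M P x \<in> U)"

definition indecomposable :: "'g set \<Rightarrow> 'g rep \<Rightarrow> bool" where
  "indecomposable L M \<longleftrightarrow> rep_space M \<noteq> {0}
     \<and> (\<forall>U W. subrep L U M \<and> subrep L W M \<and> U \<inter> W = {0}
            \<and> {u + w |u w. u \<in> U \<and> w \<in> W} = rep_space M
          \<longrightarrow> U = {0} \<or> W = {0})"

section \<open>Wildness\<close>

text \<open>A representation embedding is an exact complex-linear functor that preserves
  indecomposability and reflects isomorphism. The functor consists of the map \<open>F\<close> on objects and
  the maps \<open>Fm X Y\<close> from the morphisms \<open>X \<rightarrow> Y\<close> to the morphisms \<open>F X \<rightarrow> F Y\<close>.\<close>

locale representation_embedding =
  fixes L :: "'g set" and C :: "'g rep set"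
    and L' :: "'h set" and C' :: "'h rep set"
    and F :: "'g rep \<Rightarrow> 'h rep"
    and Fm :: "'g rep \<Rightarrow> 'g rep \<Rightarrow> (vec \<Rightarrow> vec) \<Rightarrow> (vec \<Rightarrow> vec)"
  assumes obj: "X \<in> C \<Longrightarrow> F X \<in> C'"
    and mor: "X \<in> C \<Longrightarrow> Y \<in> C \<Longrightarrow> f \<in> rep_hom L X Y \<Longrightarrow> Fm X Y f \<in> rep_hom L' (F X) (F Y)"
    and ident: "X \<in> C \<Longrightarrow> Fm X X (\<lambda>x\<in>rep_space X. x) = (\<lambda>x\<in>rep_space (F X). x)"
    and comp: "X \<in> C \<Longrightarrow> Y \<in> C \<Longrightarrow> Z \<in> C \<Longrightarrow> f \<in> rep_hom L X Y \<Longrightarrow> g \<in> rep_hom L Y Z \<Longrightarrow>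
      Fm X Z (compose (rep_space X) g f) = compose (rep_space (F X)) (Fm Y Z g) (Fm X Y f)"
    and add: "X \<in> C \<Longrightarrow> Y \<in> C \<Longrightarrow> f \<in> rep_hom L X Y \<Longrightarrow> g \<in> rep_hom L X Y \<Longrightarrow>
      Fm X Y (\<lambda>x\<in>rep_space X. f x + g x) = (\<lambda>x\<in>rep_space (F X). Fm X Y f x + Fm X Y g x)"
    and scale: "X \<in> C \<Longrightarrow> Y \<in> C \<Longrightarrow> f \<in> rep_hom L X Y \<Longrightarrow>
      Fm X Y (\<lambda>x\<in>rep_space X. cscale c (f x)) = (\<lambda>x\<in>rep_space (F X). cscale c (Fm X Y f x))"
    and exact: "X \<in> C \<Longrightarrow> Y \<in> C \<Longrightarrow> Z \<in> C \<Longrightarrow> short_exact L X Y Z f g \<Longrightarrow>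
      short_exact L' (F X) (F Y) (F Z) (Fm X Y f) (Fm Y Z g)"
    and preserves_indecomposable: "X \<in> C \<Longrightarrow> indecomposable L X \<Longrightarrow> indecomposable L' (F X)"
    and reflects_iso: "X \<in> C \<Longrightarrow> Y \<in> C \<Longrightarrow> rep_isomorphic L' (F X) (F Y) \<Longrightarrow> rep_isomorphic L X Y"

text \<open>Modules over the free algebra on two generators are vector spaces with two arbitrary
  endomorphisms, here labelled by \<^typ>\<open>bool\<close>.\<close>

definition free2_fd_modules :: "bool rep set" where
  "free2_fd_modules = {M. cvs.subspace (rep_space M) \<and> finite_dimensional (rep_space M)
     \<and> (\<forall>b. linear_between (rep_space M) (rep_space M) (rep_act M b))}"

definition wild :: "'h set \<Rightarrow> 'h rep set \<Rightarrow> bool" where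
  "wild L C \<longleftrightarrow> (\<exists>F Fm. representation_embedding (UNIV :: bool set) free2_fd_modules L C F Fm)"

section \<open>The Weyl algebra and the centralizer of the Euler operator\<close>

text \<open>Polynomials over the complex numbers in the variables \<open>t\<^sub>i\<close>, where \<open>i\<close> runs through the
  finite index type \<open>'i\<close>. A monomial is its exponent vector.\<close>

type_synonym 'i cpoly = "('i \<Rightarrow>\<^sub>0 nat) \<Rightarrow>\<^sub>0 complex"
type_synonym 'i operator = "'i cpoly \<Rightarrow> 'i cpoly"

definition mult_t :: "'i \<Rightarrow> 'i operator" where
  "mult_t i p = Poly_Mapping.single (Poly_Mapping.single i 1) 1 * p"

text \<open>If \<open>t\<^sub>i\<close> does not occur in the monomial \<open>m\<close>, the subtraction of exponents truncates, but
  then the coefficient is zero.\<close>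

definition deriv_t :: "'i \<Rightarrow> 'i operator" where
  "deriv_t i p = (\<Sum>m\<in>Poly_Mapping.keys p.
     Poly_Mapping.single (m - Poly_Mapping.single i 1)
       (of_nat (Poly_Mapping.lookup m i) * Poly_Mapping.lookup p m))"

inductive_set weyl :: "'i::finite operator set" where
  scalar: "cscale c \<in> weyl"
| mult: "mult_t i \<in> weyl"
| deriv: "deriv_t i \<in> weyl"
| add: "P \<in> weyl \<Longrightarrow> Q \<in> weyl \<Longrightarrow> (\<lambda>p. P p + Q p) \<in> weyl"
| comp: "P \<in> weyl \<Longrightarrow> Q \<in> weyl \<Longrightarrow> P \<circ> Q \<in> weyl"

definition theta :: "'i \<Rightarrow> 'i operator" where
  "theta i = mult_t i \<circ> deriv_t i"

definition euler :: "'i::finite operator" where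
  "euler = (\<lambda>p. \<Sum>i\<in>UNIV. theta i p)"

definition weyl_centralizer :: "'i::finite operator set" where
  "weyl_centralizer = {P \<in> weyl. P \<circ> euler = euler \<circ> P}"

section \<open>Generalized weight modules\<close>

definition operator_module :: "'i operator set \<Rightarrow> 'i operator rep \<Rightarrow> bool" where
  "operator_module A M \<longleftrightarrow> cvs.subspace (rep_space M)
     \<and> (\<forall>P\<in>A. linear_between (rep_space M) (rep_space M) (rep_act M P))
     \<and> (\<forall>c. cscale c \<in> A \<longrightarrow> (\<forall>x\<in>rep_space M. rep_act M (cscale c) x = cscale c x))
     \<and> (\<forall>P\<in>A. \<forall>Q\<in>A. \<forall>x\<in>rep_space M.
          rep_act M (\<lambda>p. P p + Q p) x = rep_act M P x + rep_act M Q x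
          \<and> rep_act M (P \<circ> Q) x = rep_act M P (rep_act M Q x))"

definition weight_space :: "'i::finite operator rep \<Rightarrow> complex ^ 'i \<Rightarrow> vec set" where
  "weight_space M \<mu> = {m \<in> rep_space M. \<exists>N>0. \<forall>i.
     ((\<lambda>x. rep_act M (theta i) x - cscale (\<mu> $ i) x) ^^ N) m = 0}"

definition generalized_weight_module :: "'i::finite operator rep \<Rightarrow> bool" where
  "generalized_weight_module M \<longleftrightarrow> operator_module weyl_centralizer M
     \<and> (\<forall>m\<in>rep_space M. \<exists>!v. (\<forall>\<mu>. v \<mu> \<in> weight_space M \<mu>)
          \<and> finite {\<mu>. v \<mu> \<noteq> 0} \<and> m = (\<Sum>\<mu> | v \<mu> \<noteq> 0. v \<mu>))"

definition weight_support :: "'i::finite operator rep \<Rightarrow> (complex ^ 'i) set" where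
  "weight_support M = {\<mu>. weight_space M \<mu> \<noteq> {0}}"

definition bDEH_0 :: "complex \<Rightarrow> 'i::finite operator rep set" where
  "bDEH_0 a = {M. generalized_weight_module M
     \<and> (\<forall>\<mu>. finite_dimensional (weight_space M \<mu>))
     \<and> (\<forall>m\<in>rep_space M. \<exists>N. ((\<lambda>x. rep_act M euler x - cscale a x) ^^ N) m = 0)
     \<and> weight_support M \<subseteq> {\<mu>. \<forall>i. \<mu> $ i \<in> \<int>}}"

end

theory Submission
  imports Defs "HOL-Computational_Algebra.Polynomial"
begin

text \<open>Modules over \<open>C[X,Y]/(X,Y)^3\<close> are already wild. The requirement that
  \<open>X^2\<close> act as the identity from top to bottom identifies the two outer copies of
  \<open>U\<close>, so \<open>X Y\<close> and \<open>Y^2\<close> become endomorphisms of one space;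
  three quadratic monomials with their two linear predecessors and a generator account for the four
  layers. Both variables are available because only \<open>E - a\<close> has to be locally
  nilpotent: here it acts as \<open>X + Y\<close>, while strict equality \<open>E = a\<close> would
  force \<open>Y = -X\<close>. The algebra is given as a set of operators, without generators and
  relations, so a module structure cannot be checked on relations. Instead, each operator is sent to
  its coefficient functions, indexed by exponent shift. Compatibility with sums and products is
  proved on large honest exponents and carries over to arbitrary ring-valued exponents because the
  coefficients are unique. In the monomial basis \<open>t_i0 d_j\<close> has coefficient
  \<open>mu_j\<close>, which is zero or merely nilpotent on the wall \<open>mu_j = 0\<close>.
  Rescaling by factorials moves these zeros to the opposite operators
  \<open>t_j d_i0\<close>.\<close>

text \<open>
  Given a vector space \<open>U\<close> with endomorphisms \<open>A\<close> and \<open>B\<close>, let nilpotent commuting operators \<open>X\<close> and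
  \<open>Y\<close> act on \<open>U\<^sup>4\<close> such that \<open>X\<^sup>2\<close>, \<open>X Y\<close>, \<open>Y\<^sup>2\<close> map the top copy of \<open>U\<close> to the bottom copy by
  \<open>1\<close>, \<open>A\<close>, \<open>B\<close>. Place \<open>U\<^sup>4\<close> at every integral weight \<open>\<mu>\<close> with \<open>|\<mu>| = a\<close> and let \<open>t\<^sub>i \<partial>\<^sub>i\<close> act there as
  \<open>\<mu>\<^sub>i\<close>, plus \<open>X\<close> for \<open>i = i0\<close> and plus \<open>Y\<close> for \<open>i = i1\<close>. A differential operator is determined by
  its matrix entries, which are polynomial functions of the exponents and can therefore be evaluated
  at negative and nilpotently perturbed exponents; this defines the module. The basis of monomials is
  rescaled such that each \<open>t\<^sub>i\<^sub>0 \<partial>\<^sub>j\<close> with \<open>j \<noteq> i0\<close> becomes an invertible shift, so that no wall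
  between the weights disconnects the module. A morphism of such modules preserves the weights, and
  it maps the bottom layer to the bottom layer, where it induces a morphism of the underlying
  \<open>(U, A, B)\<close>; isomorphisms and idempotents are detected there, because an endomorphism which vanishes
  on the bottom layer is nilpotent.
\<close>

section \<open>Countable direct sums inside the space of finitely supported functions\<close>

definition slot_code :: "'b::countable \<times> nat \<Rightarrow> nat" where
  "slot_code = to_nat_on UNIV"

lemma bij_slot_code: "bij (slot_code :: 'b::countable \<times> nat \<Rightarrow> nat)"
proof -
  have "infinite (UNIV :: ('b \<times> nat) set)"
    by (simp add: finite_prod)
  then show ?thesis
    unfolding slot_code_def by (intro to_nat_on_infinite) auto
qed

lemma inv_slot_code [simp]: "inv slot_code (slot_code x) = x"
  using bij_slot_code by (metis bij_is_inj inv_f_f)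

lift_definition slot :: "'b::countable \<Rightarrow> vec \<Rightarrow> vec"
  is "\<lambda>b w k. w (slot_code (b, k))"
proof -
  fix b :: 'b and w :: "nat \<Rightarrow> complex"
  assume fin: "finite {x. w x \<noteq> 0}"
  have "inj (\<lambda>k. slot_code (b, k))"
    using bij_slot_code unfolding bij_def inj_def by (metis prod.inject)
  from finite_vimageI[OF fin this] show "finite {k. w (slot_code (b, k)) \<noteq> 0}"
    by (simp add: vimage_def)
qed

text \<open>This inverts the family of \<open>slot\<close> maps, but only on families with finitely
  many nonzero members; otherwise \<open>Abs_poly_mapping\<close> receives a function of infinite
  support and its value is meaningless.\<close>

definition assemble :: "('b::countable \<Rightarrow> vec) \<Rightarrow> vec" where
  "assemble G = Abs_poly_mapping (\<lambda>n. case inv slot_code n of (b, k) \<Rightarrow> Poly_Mapping.lookup (G b) k)"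

lemma lookup_cscale [simp]: "Poly_Mapping.lookup (cscale c f) k = c * Poly_Mapping.lookup f k"
  by transfer simp

lemma slot_add [simp]: "slot b (v + w) = slot b v + slot b w"
  by transfer simp

lemma slot_diff [simp]: "slot b (v - w) = slot b v - slot b w"
  by transfer simp

lemma slot_zero [simp]: "slot b 0 = 0"
  by transfer simp

lemma slot_cscale [simp]: "slot b (cscale c w) = cscale c (slot b w)"
  by transfer simp

lemma slot_sum [simp]: "slot b (sum f S) = (\<Sum>s\<in>S. slot b (f s))"
  by (induction S rule: infinite_finite_induct) auto

lemma slot_eqI:
  assumes "\<And>b :: 'b::countable. slot b v = slot b w"
  shows "v = w"
proof (rule poly_mapping_eqI)
  fix n
  obtain b :: 'b and k where n: "n = slot_code (b, k)"
    by (metis bij_slot_code bij_pointE surj_pair)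
  have "Poly_Mapping.lookup (slot b v) k = Poly_Mapping.lookup (slot b w) k"
    using assms by simp
  then show "Poly_Mapping.lookup v n = Poly_Mapping.lookup w n"
    unfolding n by transfer
qed

lemma finite_slots: "finite {b :: 'b::countable. slot b w \<noteq> 0}"
proof (rule finite_subset)
  show "{b :: 'b. slot b w \<noteq> 0} \<subseteq> (\<lambda>n. fst (inv slot_code n)) ` Poly_Mapping.keys w"
  proof
    fix b :: 'b
    assume "b \<in> {b. slot b w \<noteq> 0}"
    then obtain k where "Poly_Mapping.lookup (slot b w) k \<noteq> 0"
      by (metis mem_Collect_eq poly_mapping_eqI lookup_zero)
    then have "slot_code (b, k) \<in> Poly_Mapping.keys w"
      by (simp add: slot.rep_eq in_keys_iff)
    moreover have "fst (inv slot_code (slot_code (b, k))) = b"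
      by simp
    ultimately show "b \<in> (\<lambda>n. fst (inv slot_code n)) ` Poly_Mapping.keys w"
      by force
  qed
qed simp

lemma slot_assemble:
  fixes G :: "'b::countable \<Rightarrow> vec"
  assumes fin: "finite {b. G b \<noteq> 0}"
  shows "slot b (assemble G) = G b"
proof -
  let ?f = "\<lambda>n. case inv slot_code n of (b, k) \<Rightarrow> Poly_Mapping.lookup (G b) k"
  have "{n. ?f n \<noteq> 0} \<subseteq>
      slot_code ` (SIGMA b:{b. G b \<noteq> 0}. Poly_Mapping.keys (G b))"
  proof
    fix n
    assume n: "n \<in> {n. ?f n \<noteq> 0}"
    obtain b :: 'b and k where bk: "n = slot_code (b, k)"
      by (metis bij_slot_code bij_pointE surj_pair)
    then have "(b, k) \<in> (SIGMA b:{b. G b \<noteq> 0}. Poly_Mapping.keys (G b))"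
      using n by (auto simp: in_keys_iff)
    with bk show "n \<in> slot_code ` (SIGMA b:{b. G b \<noteq> 0}. Poly_Mapping.keys (G b))"
      by blast
  qed
  then have "finite {n. ?f n \<noteq> 0}"
    by (rule finite_subset) (use fin in auto)
  then have "Poly_Mapping.lookup (assemble G) = ?f"
    unfolding assemble_def by (rule lookup_Abs_poly_mapping)
  then show ?thesis
    by (intro poly_mapping_eqI) (simp add: slot.rep_eq)
qed

section \<open>Separately polynomial functions\<close>

text \<open>Exponents take values in this ring. Being an integral domain of characteristic zero, it
  admits the vanishing argument for polynomial functions, and it contains room for the perturbations
  \<open>X\<close> and \<open>Y\<close>.\<close>

type_synonym bipoly = "complex poly poly"

definition vupd :: "'a ^ 'i \<Rightarrow> 'i \<Rightarrow> 'a \<Rightarrow> 'a ^ 'i" where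
  "vupd x i z = (\<chi> j. if j = i then z else x $ j)"

text \<open>A substitute for multivariate polynomials: the property is stable under sums, products
  and integer shifts, and values on a grid of large naturals determine such a function. Nothing more
  is asked of coefficients.\<close>

definition separately_poly :: "('a::comm_ring_1 ^ 'i \<Rightarrow> 'a) \<Rightarrow> bool" where
  "separately_poly f \<longleftrightarrow> (\<forall>x i. \<exists>p. \<forall>z. f (vupd x i z) = poly p z)"

lemma separately_poly_const: "separately_poly (\<lambda>_. c)"
  unfolding separately_poly_def by (metis poly_pCons mult_zero_right add.right_neutral poly_0)

lemma separately_poly_coord: "separately_poly (\<lambda>x. x $ i)"
  unfolding separately_poly_def
proof (intro allI)
  fix x :: "'a ^ 'b" and j
  show "\<exists>p. \<forall>z. vupd x j z $ i = poly p z"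
    by (cases "i = j") (auto simp: vupd_def intro: exI[of _ "[:0, 1:]"] exI[of _ "[:x $ i:]"])
qed

lemma separately_poly_add:
  assumes "separately_poly f" "separately_poly g"
  shows "separately_poly (\<lambda>x. f x + g x)"
  unfolding separately_poly_def
proof (intro allI)
  fix x i
  obtain p q where "\<And>z. f (vupd x i z) = poly p z" "\<And>z. g (vupd x i z) = poly q z"
    using assms unfolding separately_poly_def by metis
  then show "\<exists>p. \<forall>z. f (vupd x i z) + g (vupd x i z) = poly p z"
    by (intro exI[of _ "p + q"]) simp
qed

lemma separately_poly_mult:
  assumes "separately_poly f" "separately_poly g"
  shows "separately_poly (\<lambda>x. f x * g x)"
  unfolding separately_poly_def
proof (intro allI)
  fix x i
  obtain p q where "\<And>z. f (vupd x i z) = poly p z" "\<And>z. g (vupd x i z) = poly q z"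
    using assms unfolding separately_poly_def by metis
  then show "\<exists>p. \<forall>z. f (vupd x i z) * g (vupd x i z) = poly p z"
    by (intro exI[of _ "p * q"]) simp
qed

lemma separately_poly_sum:
  assumes "\<And>s. s \<in> S \<Longrightarrow> separately_poly (f s)"
  shows "separately_poly (\<lambda>x. \<Sum>s\<in>S. f s x)"
  using assms
  by (induction S rule: infinite_finite_induct)
     (auto intro: separately_poly_const separately_poly_add)

lemma separately_poly_shift:
  assumes "separately_poly f"
  shows "separately_poly (\<lambda>x. f (x + l))"
  unfolding separately_poly_def
proof (intro allI)
  fix x i
  obtain p where p: "\<And>z. f (vupd (x + l) i z) = poly p z"
    using assms unfolding separately_poly_def by metis
  have "vupd x i z + l = vupd (x + l) i (z + l $ i)" for z
    by (auto simp: vupd_def vec_eq_iff)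
  then show "\<exists>p. \<forall>z. f (vupd x i z + l) = poly p z"
    by (intro exI[of _ "pcompose p [:l $ i, 1:]"]) (simp add: p poly_pcompose add.commute[of _ "l $ i"])
qed

text \<open>A one-variable polynomial with infinitely many roots is zero; the coordinates are freed
  from the grid one after the other.\<close>

lemma separately_poly_eq_0:
  fixes f :: "'a::{idom,ring_char_0} ^ 'i::finite \<Rightarrow> 'a"
  assumes f: "separately_poly f"
    and zero: "\<And>m :: 'i \<Rightarrow> nat. (\<And>i. N \<le> m i) \<Longrightarrow> f (\<chi> i. of_nat (m i)) = 0"
  shows "f x = 0"
proof -
  \<comment> \<open>\<open>J\<close> collects the coordinates that may already be arbitrary; those
    outside are still naturals above \<open>N\<close>.\<close>
  have "\<forall>x. (\<forall>i. i \<notin> J \<longrightarrow> (\<exists>n\<ge>N. x $ i = of_nat n)) \<longrightarrow> f x = 0" if "finite J" for J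
    using that
  proof (induction J rule: finite_induct)
    case empty
    show ?case
    proof (intro allI impI)
      fix x :: "'a ^ 'i"
      assume "\<forall>i. i \<notin> {} \<longrightarrow> (\<exists>n\<ge>N. x $ i = of_nat n)"
      then obtain m where m: "\<And>i. N \<le> m i" "\<And>i. x $ i = of_nat (m i)"
        by (metis empty_iff)
      have "x = (\<chi> i. of_nat (m i))"
        by (simp add: vec_eq_iff m)
      with zero m show "f x = 0"
        by simp
    qed
  next
    case (insert j J)
    show ?case
    proof (intro allI impI)
      fix x :: "'a ^ 'i"
      assume x: "\<forall>i. i \<notin> insert j J \<longrightarrow> (\<exists>n\<ge>N. x $ i = of_nat n)"
      obtain p where p: "\<And>z. f (vupd x j z) = poly p z"
        using f unfolding separately_poly_def by metis
      have "poly p (of_nat n) = 0" if "n \<ge> N" for n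
        using insert.IH x that unfolding p[symmetric] by (auto simp: vupd_def)
      then have "of_nat ` {N..} \<subseteq> {z. poly p z = 0}"
        by auto
      moreover have "infinite (of_nat ` {N..} :: 'a set)"
        by (simp add: finite_image_iff inj_on_def infinite_Ici)
      ultimately have "infinite {z. poly p z = 0}"
        using finite_subset by blast
      then have "p = 0"
        using poly_roots_finite by blast
      moreover have "vupd x j (x $ j) = x"
        by (simp add: vupd_def vec_eq_iff)
      ultimately show "f x = 0"
        using p[of "x $ j"] by simp
    qed
  qed
  from this[of UNIV] show ?thesis
    by simp
qed

section \<open>Operators on polynomials\<close>

abbreviation tmono :: "('i \<Rightarrow>\<^sub>0 nat) \<Rightarrow> 'i cpoly" where
  "tmono m \<equiv> Poly_Mapping.single m 1"

definition linear_op :: "'i operator \<Rightarrow> bool" where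
  "linear_op P \<longleftrightarrow> (\<forall>p q. P (p + q) = P p + P q) \<and> (\<forall>c p. P (cscale c p) = cscale c (P p))"

lemma linear_opD:
  assumes "linear_op P"
  shows "P (p + q) = P p + P q" "P (cscale c p) = cscale c (P p)"
  using assms by (auto simp: linear_op_def)

lemma cscale_0 [simp]: "cscale 0 p = 0" "cscale c 0 = 0"
  by simp_all

lemma linear_op_0:
  assumes "linear_op P"
  shows "P 0 = 0"
  using linear_opD(2)[OF assms, of 0 0] by simp

lemma linear_op_sum:
  assumes "linear_op P"
  shows "P (sum f S) = (\<Sum>s\<in>S. P (f s))"
  using linear_op_0[OF assms]
  by (induction S rule: infinite_finite_induct) (auto simp: linear_opD[OF assms])

lemma linear_op_expand:
  assumes P: "linear_op P"
  shows "P p = (\<Sum>m\<in>Poly_Mapping.keys p. cscale (Poly_Mapping.lookup p m) (P (tmono m)))"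
proof -
  have "p = (\<Sum>m\<in>Poly_Mapping.keys p. cscale (Poly_Mapping.lookup p m) (tmono m))"
    by (rule poly_mapping_eqI)
       (auto simp: lookup_sum lookup_single when_def if_distrib sum.delta in_keys_iff cong: if_cong)
  then have "P p = P (\<Sum>m\<in>Poly_Mapping.keys p. cscale (Poly_Mapping.lookup p m) (tmono m))"
    by simp
  then show ?thesis
    by (simp add: linear_op_sum[OF P] linear_opD[OF P])
qed

lemma linear_op_eqI:
  assumes "linear_op P" "linear_op Q" "\<And>m. P (tmono m) = Q (tmono m)"
  shows "P = Q"
  by (rule ext, subst (1 2) linear_op_expand) (simp_all add: assms)

lemma linear_op_cscale: "linear_op (cscale c)"
  by (simp add: linear_op_def cvs.scale_right_distrib mult.commute)

lemma linear_op_mult_t: "linear_op (mult_t i)"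
proof -
  have scale: "cscale c p = Poly_Mapping.single 0 c * p" for c and p :: "'a cpoly"
    unfolding mult_map_scale_conv_mult[symmetric]
    by (rule poly_mapping_eqI) (simp add: map.rep_eq when_def)
  have "q * cscale c p = cscale c (q * p)" for q p :: "'a cpoly" and c
    by (simp add: scale mult.left_commute)
  then show ?thesis
    by (simp add: linear_op_def mult_t_def distrib_left)
qed

text \<open>Additivity compares sums over the keys of three different polynomials, so a common index
  set is required.\<close>

lemma deriv_t_superset:
  assumes "finite S" "Poly_Mapping.keys p \<subseteq> S"
  shows "deriv_t i p = (\<Sum>m\<in>S. Poly_Mapping.single (m - Poly_Mapping.single i 1)
       (of_nat (Poly_Mapping.lookup m i) * Poly_Mapping.lookup p m))"
  unfolding deriv_t_def using assms
  by (intro sum.mono_neutral_left) (auto simp: in_keys_iff)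

lemma linear_op_deriv_t: "linear_op (deriv_t i)"
  unfolding linear_op_def
proof (intro conjI allI)
  fix p q :: "'a cpoly" and c
  let ?S = "Poly_Mapping.keys p \<union> Poly_Mapping.keys q"
  have "deriv_t i (p + q) = (\<Sum>m\<in>?S. Poly_Mapping.single (m - Poly_Mapping.single i 1)
       (of_nat (Poly_Mapping.lookup m i) * Poly_Mapping.lookup (p + q) m))"
    by (rule deriv_t_superset) (auto simp: in_keys_iff lookup_add)
  also have "\<dots> = deriv_t i p + deriv_t i q"
    by (simp add: deriv_t_superset[of ?S] lookup_add distrib_left single_add sum.distrib)
  finally show "deriv_t i (p + q) = deriv_t i p + deriv_t i q" .
  have single: "Poly_Mapping.single k (c * x) = cscale c (Poly_Mapping.single k x)"
    for k :: "'a \<Rightarrow>\<^sub>0 nat" and x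
    by (rule poly_mapping_eqI) (simp add: lookup_single when_def)
  have "deriv_t i (cscale c p) = (\<Sum>m\<in>Poly_Mapping.keys p.
       Poly_Mapping.single (m - Poly_Mapping.single i 1)
       (of_nat (Poly_Mapping.lookup m i) * Poly_Mapping.lookup (cscale c p) m))"
    by (rule deriv_t_superset) (auto simp: in_keys_iff)
  also have "\<dots> = cscale c (deriv_t i p)"
    by (simp add: deriv_t_def cvs.scale_sum_right single[symmetric] mult.left_commute)
  finally show "deriv_t i (cscale c p) = cscale c (deriv_t i p)" .
qed

lemma linear_op_comp: "linear_op P \<Longrightarrow> linear_op Q \<Longrightarrow> linear_op (P \<circ> Q)"
  by (simp add: linear_op_def)

lemma linear_op_add: "linear_op P \<Longrightarrow> linear_op Q \<Longrightarrow> linear_op (\<lambda>p. P p + Q p)"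
  by (simp add: linear_op_def cvs.scale_right_distrib)

lemma linear_op_weyl: "P \<in> weyl \<Longrightarrow> linear_op P"
  by (induction rule: weyl.induct)
     (rule linear_op_cscale linear_op_mult_t linear_op_deriv_t linear_op_add linear_op_comp;
      assumption?)+

lemma deriv_t_mono:
  "deriv_t i (tmono m)
     = Poly_Mapping.single (m - Poly_Mapping.single i 1) (of_nat (Poly_Mapping.lookup m i))"
  by (simp add: deriv_t_def)

lemma mult_t_single:
  "mult_t i (Poly_Mapping.single m c) = Poly_Mapping.single (Poly_Mapping.single i 1 + m) c"
  by (simp add: mult_t_def mult_single)

lemma theta_mono: "theta i (tmono m) = cscale (of_nat (Poly_Mapping.lookup m i)) (tmono m)"
proof (cases "Poly_Mapping.lookup m i = 0")
  case True
  then show ?thesis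
    by (simp add: theta_def deriv_t_mono mult_t_def)
next
  case False
  then have "Poly_Mapping.single i 1 + (m - Poly_Mapping.single i 1) = m"
    by (intro poly_mapping_eqI) (auto simp: lookup_add lookup_minus lookup_single when_def)
  then show ?thesis
    by (intro poly_mapping_eqI)
       (simp add: theta_def deriv_t_mono mult_t_single lookup_single when_def)
qed

section \<open>Elements of the Weyl algebra and of the centralizer\<close>

lemma sum_in_weyl:
  fixes P :: "'s \<Rightarrow> 'i::finite operator"
  assumes "finite S" "\<And>s. s \<in> S \<Longrightarrow> P s \<in> weyl"
  shows "(\<lambda>p. \<Sum>s\<in>S. P s p) \<in> weyl"
  using assms
proof (induction S rule: finite_induct)
  case empty
  have "(\<lambda>p :: 'i cpoly. 0 :: 'i cpoly) = cscale 0"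
    by auto
  then show ?case
    using weyl.scalar[of 0] by simp
next
  case (insert s S)
  then show ?case
    using weyl.add[of "P s" "\<lambda>p. \<Sum>s\<in>S. P s p"] by simp
qed

lemma theta_in_weyl: "theta i \<in> weyl"
  unfolding theta_def by (intro weyl.intros)

lemma euler_in_weyl: "euler \<in> weyl"
  unfolding euler_def by (intro sum_in_weyl theta_in_weyl) simp

lemma euler_mono:
  "euler (tmono m) = cscale (of_nat (\<Sum>i\<in>UNIV. Poly_Mapping.lookup m i)) (tmono m)"
  by (simp add: euler_def theta_mono cvs.scale_sum_left)

lemma theta_in_centralizer: "theta i \<in> weyl_centralizer"
  unfolding weyl_centralizer_def
proof (intro CollectI conjI theta_in_weyl)
  note lin = linear_op_weyl[OF theta_in_weyl] linear_op_weyl[OF euler_in_weyl]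
  show "theta i \<circ> euler = euler \<circ> theta i"
    by (rule linear_op_eqI)
       (simp_all add: lin linear_op_comp linear_opD(2)[OF lin(1)] linear_opD(2)[OF lin(2)]
          theta_mono euler_mono mult.commute)
qed

lemma mult_deriv_in_weyl: "mult_t i \<circ> deriv_t j \<in> weyl"
  by (intro weyl.intros)

lemma mult_deriv_mono:
  "(mult_t i \<circ> deriv_t j) (tmono m)
     = cscale (of_nat (Poly_Mapping.lookup m j))
         (tmono (Poly_Mapping.single i 1 + (m - Poly_Mapping.single j 1)))"
  by (rule poly_mapping_eqI) (simp add: deriv_t_mono mult_t_single lookup_single when_def)

lemma mult_deriv_in_centralizer: "mult_t i \<circ> deriv_t j \<in> weyl_centralizer"
  unfolding weyl_centralizer_def
proof (intro CollectI conjI mult_deriv_in_weyl)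
  let ?P = "mult_t i \<circ> deriv_t j"
  note lin = linear_op_weyl[OF mult_deriv_in_weyl[of i j]] linear_op_weyl[OF euler_in_weyl]
  have "(?P \<circ> euler) (tmono m) = (euler \<circ> ?P) (tmono m)" for m
  proof (cases "Poly_Mapping.lookup m j = 0")
    case True
    then show ?thesis
      by (simp only: o_apply[of ?P] o_apply[of euler] euler_mono linear_opD[OF lin(1)]
          linear_opD[OF lin(2)] mult_deriv_mono) (simp add: linear_op_0[OF lin(2)])
  next
    case False
    let ?m = "Poly_Mapping.single i 1 + (m - Poly_Mapping.single j 1)"
    have eq: "Poly_Mapping.single j 1 + (m - Poly_Mapping.single j 1) = m"
      using False
      by (intro poly_mapping_eqI) (auto simp: lookup_add lookup_minus lookup_single when_def)
    \<comment> \<open>Source and target monomial both arise from \<open>m - single j 1\<close> by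
      raising one exponent, so they have equal total degree and \<open>euler\<close> acts on them by
      the same scalar.\<close>
    have "(\<Sum>l\<in>UNIV. Poly_Mapping.lookup (Poly_Mapping.single k 1 + q) l)
       = Suc (\<Sum>l\<in>UNIV. Poly_Mapping.lookup q l)" for k :: 'a and q
      by (simp add: lookup_add sum.distrib lookup_single when_def)
    from this[of i "m - Poly_Mapping.single j 1"] this[of j "m - Poly_Mapping.single j 1"]
    have "(\<Sum>l\<in>UNIV. Poly_Mapping.lookup ?m l) = (\<Sum>l\<in>UNIV. Poly_Mapping.lookup m l)"
      by (simp only: eq)
    then show ?thesis
      by (simp only: o_apply[of ?P] o_apply[of euler] euler_mono linear_opD[OF lin(1)]
          linear_opD[OF lin(2)] mult_deriv_mono cvs.scale_scale mult.commute)
  qed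
  then show "?P \<circ> euler = euler \<circ> ?P"
    by (intro linear_op_eqI linear_op_comp lin)
qed

section \<open>Symbols of differential operators\<close>

definition const_bipoly :: "complex \<Rightarrow> bipoly" where
  "const_bipoly c = [:[:c:]:]"

lemma const_bipoly_simps [simp]:
  "const_bipoly 0 = 0" "const_bipoly 1 = 1"
  "const_bipoly (c + d) = const_bipoly c + const_bipoly d"
  "const_bipoly (c * d) = const_bipoly c * const_bipoly d"
  by (simp_all add: const_bipoly_def one_pCons)

lemma const_bipoly_of_nat [simp]: "const_bipoly (of_nat n) = of_nat n"
  by (induction n) simp_all

lemma const_bipoly_sum: "const_bipoly (sum f S) = (\<Sum>s\<in>S. const_bipoly (f s))"
  by (induction S rule: infinite_finite_induct) auto

definition lattice_pt :: "int ^ 'i \<Rightarrow> bipoly ^ 'i" where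
  "lattice_pt k = (\<chi> i. of_int (k $ i))"

lemma lattice_pt_add: "lattice_pt (k + l) = lattice_pt k + lattice_pt l"
  by (simp add: lattice_pt_def vec_eq_iff)

lemma lattice_pt_nth [simp]: "lattice_pt k $ i = of_int (k $ i)"
  by (simp add: lattice_pt_def)

definition expo :: "('i \<Rightarrow>\<^sub>0 nat) \<Rightarrow> int ^ 'i" where
  "expo m = (\<chi> i. int (Poly_Mapping.lookup m i))"

lemma expo_nth [simp]: "expo m $ i = int (Poly_Mapping.lookup m i)"
  by (simp add: expo_def)

lemma expo_inject [simp]: "expo m = expo m' \<longleftrightarrow> m = m'"
  by (auto simp: vec_eq_iff intro: poly_mapping_eqI)

lemma expo_surj:
  fixes k :: "int ^ 'i::finite"
  assumes "\<And>i. 0 \<le> k $ i"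
  obtains m where "expo m = k"
proof
  show "expo (Abs_poly_mapping (\<lambda>i. nat (k $ i))) = k"
    by (simp add: vec_eq_iff assms)
qed

definition support :: "(int ^ 'i \<Rightarrow> bipoly ^ 'i \<Rightarrow> bipoly) \<Rightarrow> (int ^ 'i) set" where
  "support d = {k. \<exists>x. d k x \<noteq> 0}"

lemma not_in_support: "k \<notin> support d \<Longrightarrow> d k x = 0"
  by (simp add: support_def)

definition weight_fact :: "'i::finite \<Rightarrow> ('i \<Rightarrow>\<^sub>0 nat) \<Rightarrow> complex" where
  "weight_fact i0 m = (\<Prod>j\<in>UNIV - {i0}. fact (Poly_Mapping.lookup m j))"

lemma weight_fact_nonzero [simp]: "weight_fact i0 m \<noteq> 0"
  by (simp add: weight_fact_def)

text \<open>The matrix entries of \<open>P\<close> in the basis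
  \<open>t\<^sup>m / \<Prod>\<^sub>j\<^sub>\<noteq>\<^sub>i\<^sub>0 m\<^sub>j!\<close>, in which \<open>t\<^sub>i\<^sub>0 \<partial>\<^sub>j\<close> is a pure shift of the exponents for every
  \<open>j \<noteq> i0\<close>.\<close>

definition entry :: "'i::finite \<Rightarrow> 'i operator \<Rightarrow> ('i \<Rightarrow>\<^sub>0 nat) \<Rightarrow> ('i \<Rightarrow>\<^sub>0 nat) \<Rightarrow> complex" where
  "entry i0 P m m' =
     Poly_Mapping.lookup (P (tmono m)) m' * weight_fact i0 m' / weight_fact i0 m"

text \<open>The components of a symbol are only compared with the entries at large exponents, away from the
  truncation at exponent zero, but being polynomial in each variable they are determined by these
  values.\<close>

definition is_symbol ::
  "'i::finite \<Rightarrow> 'i operator \<Rightarrow> (int ^ 'i \<Rightarrow> bipoly ^ 'i \<Rightarrow> bipoly) \<Rightarrow> bool" where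
  "is_symbol i0 P d \<longleftrightarrow> finite (support d) \<and> (\<forall>k. separately_poly (d k))
     \<and> (\<exists>N. \<forall>m m'. (\<forall>i. N \<le> Poly_Mapping.lookup m i) \<longrightarrow>
          const_bipoly (entry i0 P m m') = d (expo m' - expo m) (lattice_pt (expo m)))"

lemma is_symbolI:
  assumes "finite (support d)" "\<And>k. separately_poly (d k)"
    and "\<And>m m'. (\<And>i. N \<le> Poly_Mapping.lookup m i) \<Longrightarrow>
          const_bipoly (entry i0 P m m') = d (expo m' - expo m) (lattice_pt (expo m))"
  shows "is_symbol i0 P d"
  using assms unfolding is_symbol_def by blast

lemma is_symbolD:
  assumes "is_symbol i0 P d"
  obtains N where "\<And>m m'. (\<And>i. N \<le> Poly_Mapping.lookup m i) \<Longrightarrow>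
          const_bipoly (entry i0 P m m') = d (expo m' - expo m) (lattice_pt (expo m))"
  using assms unfolding is_symbol_def by blast

lemma support_bound:
  fixes S :: "(int ^ 'i::finite) set"
  assumes "finite S"
  obtains K where "\<And>k i. k \<in> S \<Longrightarrow> \<bar>k $ i\<bar> \<le> int K"
proof
  fix k i
  assume "k \<in> S"
  then have "\<bar>k $ i\<bar> \<le> Max ((\<lambda>(k, i). \<bar>k $ i\<bar>) ` (S \<times> UNIV))"
    using assms by (intro Max_ge) (auto intro!: rev_image_eqI[of "(k, i)"])
  then show "\<bar>k $ i\<bar> \<le> int (nat (Max ((\<lambda>(k, i). \<bar>k $ i\<bar>) ` (S \<times> UNIV))))"
    by linarith
qed

text \<open>For each shift \<open>k\<close> the difference of the two coefficients vanishes on a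
  grid of large exponents, hence everywhere. This turns \<open>symbol\<close> into a function and
  makes sums and products of operators computable on symbols.\<close>

lemma is_symbol_unique:
  assumes d: "is_symbol i0 P d" and d': "is_symbol i0 P d'"
  shows "d = d'"
proof (intro ext)
  fix k :: "int ^ 'a" and x
  obtain N where N: "\<And>m m'. (\<And>i. N \<le> Poly_Mapping.lookup m i) \<Longrightarrow>
      const_bipoly (entry i0 P m m') = d (expo m' - expo m) (lattice_pt (expo m))"
    using is_symbolD[OF d] by blast
  obtain N' where N': "\<And>m m'. (\<And>i. N' \<le> Poly_Mapping.lookup m i) \<Longrightarrow>
      const_bipoly (entry i0 P m m') = d' (expo m' - expo m) (lattice_pt (expo m))"
    using is_symbolD[OF d'] by blast
  obtain K where K: "\<And>i. \<bar>k $ i\<bar> \<le> int K"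
    using support_bound[of "{k}"] by (metis finite.emptyI finite_insert insertI1)
  have "separately_poly (\<lambda>x. d k x + (- 1) * d' k x)"
    using d d' unfolding is_symbol_def
    by (intro separately_poly_add separately_poly_mult separately_poly_const) auto
  then have "d k x + (- 1) * d' k x = 0"
  \<comment> \<open>\<open>N\<close> and \<open>N'\<close> put \<open>m\<close> in the range where
    both symbols describe the entries; \<open>K\<close> keeps \<open>m + k\<close> nonnegative, so
    that it is the exponent of a monomial.\<close>
  proof (rule separately_poly_eq_0[where N = "N + N' + K"])
    fix m :: "'a \<Rightarrow> nat"
    assume m: "\<And>i. N + N' + K \<le> m i"
    let ?m = "Abs_poly_mapping m"
    have lm: "Poly_Mapping.lookup ?m i = m i" for i
      by simp
    have "0 \<le> (expo ?m + k) $ i" for i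
      using m[of i] K[of i] by (simp add: abs_le_iff)
    then obtain m' where m': "expo m' = expo ?m + k"
      using expo_surj by blast
    have "lattice_pt (expo ?m) = (\<chi> i. of_nat (m i))"
      by (simp add: vec_eq_iff)
    moreover have "d k (lattice_pt (expo ?m)) = d' k (lattice_pt (expo ?m))"
      using N[of ?m m'] N'[of ?m m'] m unfolding m' lm
      by (metis add_diff_cancel_left' add_leD1 add_leD2)
    ultimately show "d k (\<chi> i. of_nat (m i)) + - 1 * d' k (\<chi> i. of_nat (m i)) = 0"
      by simp
  qed
  then show "d k x = d' k x"
    by simp
qed

lemma is_symbol_add:
  assumes P: "is_symbol i0 P d" and Q: "is_symbol i0 Q d'"
  shows "is_symbol i0 (\<lambda>p. P p + Q p) (\<lambda>k x. d k x + d' k x)"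
proof -
  obtain N where N: "\<And>m m'. (\<And>i. N \<le> Poly_Mapping.lookup m i) \<Longrightarrow>
      const_bipoly (entry i0 P m m') = d (expo m' - expo m) (lattice_pt (expo m))"
    using is_symbolD[OF P] by blast
  obtain N' where N': "\<And>m m'. (\<And>i. N' \<le> Poly_Mapping.lookup m i) \<Longrightarrow>
      const_bipoly (entry i0 Q m m') = d' (expo m' - expo m) (lattice_pt (expo m))"
    using is_symbolD[OF Q] by blast
  show ?thesis
  proof (rule is_symbolI[where N = "N + N'"])
    show "finite (support (\<lambda>k x. d k x + d' k x))"
    proof (rule finite_subset)
      show "support (\<lambda>k x. d k x + d' k x) \<subseteq> support d \<union> support d'"
        by (auto simp: support_def)
      show "finite (support d \<union> support d')"
        using P Q by (simp add: is_symbol_def)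
    qed
    show "separately_poly (\<lambda>x. d k x + d' k x)" for k
      using P Q by (auto simp: is_symbol_def intro: separately_poly_add)
    fix m m' :: "'a \<Rightarrow>\<^sub>0 nat"
    assume m: "\<And>i. N + N' \<le> Poly_Mapping.lookup m i"
    have "entry i0 (\<lambda>p. P p + Q p) m m' = entry i0 P m m' + entry i0 Q m m'"
      by (simp add: entry_def lookup_add ring_distribs add_divide_distrib)
    then show "const_bipoly (entry i0 (\<lambda>p. P p + Q p) m m')
        = d (expo m' - expo m) (lattice_pt (expo m)) + d' (expo m' - expo m) (lattice_pt (expo m))"
      using N[of m m'] N'[of m m'] m by (metis add_leD1 add_leD2 const_bipoly_simps(3))
  qed
qed

text \<open>The product of a skew algebra of shifts with function coefficients: the right factor
  acts first and moves the exponent from \<open>x\<close> to \<open>x + l\<close>, where the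
  coefficient of the left factor is evaluated.\<close>

definition symbol_comp ::
  "(int ^ 'i \<Rightarrow> bipoly ^ 'i \<Rightarrow> bipoly) \<Rightarrow> (int ^ 'i \<Rightarrow> bipoly ^ 'i \<Rightarrow> bipoly)
     \<Rightarrow> int ^ 'i \<Rightarrow> bipoly ^ 'i \<Rightarrow> bipoly" where
  "symbol_comp d d' k x = (\<Sum>l\<in>support d'. d (k - l) (x + lattice_pt l) * d' l x)"

lemma support_symbol_comp:
  "support (symbol_comp d d') \<subseteq> (\<lambda>(k, l). k + l) ` (support d \<times> support d')"
proof
  fix k
  assume "k \<in> support (symbol_comp d d')"
  then obtain x where "(\<Sum>l\<in>support d'. d (k - l) (x + lattice_pt l) * d' l x) \<noteq> 0"
    by (auto simp: support_def[of "symbol_comp d d'"] symbol_comp_def)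
  then obtain l where "l \<in> support d'" "d (k - l) (x + lattice_pt l) \<noteq> 0"
    by (metis (no_types, lifting) mult_eq_0_iff sum.neutral)
  then have "(k - l, l) \<in> support d \<times> support d'"
    by (auto simp: support_def)
  then show "k \<in> (\<lambda>(k, l). k + l) ` (support d \<times> support d')"
    by (intro rev_image_eqI[of "(k - l, l)"]) auto
qed

lemma finite_support_symbol_comp:
  "finite (support d) \<Longrightarrow> finite (support d') \<Longrightarrow> finite (support (symbol_comp d d'))"
  by (rule finite_subset[OF support_symbol_comp]) auto

text \<open>A matrix product in the rescaled basis: the factorials of the intermediate monomial
  cancel.\<close>

lemma entry_comp:
  assumes "linear_op P"
  shows "entry i0 (P \<circ> Q) m m''
     = (\<Sum>m'\<in>Poly_Mapping.keys (Q (tmono m)). entry i0 P m' m'' * entry i0 Q m m')"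
  by (simp add: entry_def linear_op_expand[OF assms, of "Q (tmono m)"] lookup_sum
      sum_distrib_left sum_distrib_right sum_divide_distrib mult_ac)

text \<open>\<open>K\<close> bounds how far \<open>Q\<close> can lower an exponent, so every
  intermediate monomial still lies above the threshold for \<open>P\<close>.\<close>

lemma is_symbol_comp:
  assumes P: "is_symbol i0 P d" and Q: "is_symbol i0 Q d'" and lin: "linear_op P"
  shows "is_symbol i0 (P \<circ> Q) (symbol_comp d d')"
proof -
  obtain N where N: "\<And>m m'. (\<And>i. N \<le> Poly_Mapping.lookup m i) \<Longrightarrow>
      const_bipoly (entry i0 P m m') = d (expo m' - expo m) (lattice_pt (expo m))"
    using is_symbolD[OF P] by blast
  obtain N' where N': "\<And>m m'. (\<And>i. N' \<le> Poly_Mapping.lookup m i) \<Longrightarrow>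
      const_bipoly (entry i0 Q m m') = d' (expo m' - expo m) (lattice_pt (expo m))"
    using is_symbolD[OF Q] by blast
  have fin: "finite (support d)" "finite (support d')"
    using P Q by (simp_all add: is_symbol_def)
  obtain K where K: "\<And>k i. k \<in> support d' \<Longrightarrow> \<bar>k $ i\<bar> \<le> int K"
    using support_bound[OF fin(2)] by blast
  show ?thesis
  proof (rule is_symbolI[where N = "N + N' + K"])
    show "finite (support (symbol_comp d d'))"
      by (rule finite_support_symbol_comp[OF fin])
    show "separately_poly (symbol_comp d d' k)" for k
      unfolding symbol_comp_def using P Q
      by (intro separately_poly_sum separately_poly_mult separately_poly_shift)
         (auto simp: is_symbol_def)
    fix m m'' :: "'a \<Rightarrow>\<^sub>0 nat"
    assume m: "\<And>i. N + N' + K \<le> Poly_Mapping.lookup m i"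
    then have Q_entry: "const_bipoly (entry i0 Q m m') = d' (expo m' - expo m) (lattice_pt (expo m))"
      for m'
      by (intro N') (meson add_leD1 add_leD2)
    let ?K = "Poly_Mapping.keys (Q (tmono m))"
    let ?g = "\<lambda>m'. expo m' - expo m"
    let ?h = "\<lambda>l. d (expo m'' - expo m - l) (lattice_pt (expo m) + lattice_pt l) * d' l (lattice_pt (expo m))"
    have inj: "inj_on ?g ?K"
      by (simp add: inj_on_def)
    have in_support: "?g m' \<in> support d'" if "m' \<in> ?K" for m'
    proof -
      have "entry i0 Q m m' \<noteq> 0"
        using that by (simp add: entry_def in_keys_iff)
      then have "const_bipoly (entry i0 Q m m') \<noteq> 0"
        by (simp add: const_bipoly_def)
      then show ?thesis
        unfolding Q_entry by (auto simp: support_def)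
    qed
    \<comment> \<open>A shift in the support of the symbol may fail to occur at this particular
      \<open>m\<close>. Since \<open>m + l\<close> is nonnegative it belongs to an actual monomial,
      whose entry is zero, and the symbol reproduces this zero.\<close>
    have "?h l = 0" if l: "l \<in> support d' - ?g ` ?K" for l
    proof -
      have "0 \<le> (expo m + l) $ i" for i
        using m[of i] K[of l i] l by (simp add: abs_le_iff)
      then obtain m' where m': "expo m' = expo m + l"
        using expo_surj by blast
      then have "?g m' = l"
        by simp
      then have "m' \<notin> ?K"
        using l by blast
      then have "entry i0 Q m m' = 0"
        by (simp add: entry_def in_keys_iff)
      then show ?thesis
        using Q_entry[of m'] m' by simp
    qed
    then have "symbol_comp d d' (expo m'' - expo m) (lattice_pt (expo m)) = sum ?h (?g ` ?K)"
      unfolding symbol_comp_def using in_support fin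
      by (intro sum.mono_neutral_right) auto
    also have "\<dots> = (\<Sum>m'\<in>?K. ?h (?g m'))"
      by (simp add: sum.reindex[OF inj])
    also have "\<dots> = (\<Sum>m'\<in>?K. const_bipoly (entry i0 P m' m'' * entry i0 Q m m'))"
    proof (rule sum.cong)
      fix m'
      assume m': "m' \<in> ?K"
      have "N \<le> Poly_Mapping.lookup m' i" for i
        using m[of i] K[OF in_support[OF m'], of i] by (simp add: abs_le_iff)
      then have "const_bipoly (entry i0 P m' m'') = d (expo m'' - expo m') (lattice_pt (expo m'))"
        by (rule N)
      moreover have "lattice_pt (expo m) + lattice_pt (expo m' - expo m) = lattice_pt (expo m')"
        by (simp add: lattice_pt_add[symmetric])
      ultimately show "?h (?g m') = const_bipoly (entry i0 P m' m'' * entry i0 Q m m')"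
        by (simp add: Q_entry)
    qed simp
    finally show "const_bipoly (entry i0 (P \<circ> Q) m m'')
        = symbol_comp d d' (expo m'' - expo m) (lattice_pt (expo m))"
      by (simp add: entry_comp[OF lin] const_bipoly_sum del: const_bipoly_simps)
  qed
qed

lemma weight_fact_Suc:
  "weight_fact i0 (Poly_Mapping.single i 1 + m)
     = (if i = i0 then 1 else of_nat (Suc (Poly_Mapping.lookup m i))) * weight_fact i0 m"
proof (cases "i = i0")
  case True
  then show ?thesis
    by (auto simp: weight_fact_def lookup_add lookup_single when_def intro!: prod.cong)
next
  case False
  have split: "weight_fact i0 q = fact (Poly_Mapping.lookup q i)
      * (\<Prod>j\<in>UNIV - {i0} - {i}. fact (Poly_Mapping.lookup q j))" for q :: "'a \<Rightarrow>\<^sub>0 nat"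
    unfolding weight_fact_def by (rule prod.remove) (use False in auto)
  have "(\<Prod>j\<in>UNIV - {i0} - {i}. fact (Poly_Mapping.lookup (Poly_Mapping.single i 1 + m) j))
      = (\<Prod>j\<in>UNIV - {i0} - {i}. fact (Poly_Mapping.lookup m j) :: complex)"
    by (auto simp: lookup_add lookup_single when_def intro!: prod.cong)
  then show ?thesis
    using False by (simp add: split lookup_add)
qed

definition mono_symbol ::
  "int ^ 'i \<Rightarrow> (bipoly ^ 'i \<Rightarrow> bipoly) \<Rightarrow> int ^ 'i \<Rightarrow> bipoly ^ 'i \<Rightarrow> bipoly" where
  "mono_symbol l f k x = (if k = l then f x else 0)"

lemma support_mono_symbol: "support (mono_symbol l f) \<subseteq> {l}"
  by (auto simp: support_def mono_symbol_def)

text \<open>Serves all operators that send a monomial to a multiple of a monomial. Exponents at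
  least 1 avoid the truncated subtraction in derivatives.\<close>

lemma is_symbol_mono_symbol:
  assumes f: "separately_poly f"
    and P: "\<And>m. (\<And>i. 1 \<le> Poly_Mapping.lookup m i) \<Longrightarrow>
        \<exists>c q. P (tmono m) = cscale c (tmono q) \<and> expo q = expo m + l
          \<and> const_bipoly (c * weight_fact i0 q / weight_fact i0 m) = f (lattice_pt (expo m))"
  shows "is_symbol i0 P (mono_symbol l f)"
proof (rule is_symbolI[where N = 1])
  show "finite (support (mono_symbol l f))"
    by (rule finite_subset[OF support_mono_symbol]) simp
  show "separately_poly (mono_symbol l f k)" for k
  proof (cases "k = l")
    case True
    then have "mono_symbol l f k = f"
      by (simp add: mono_symbol_def fun_eq_iff)
    with f show ?thesis
      by simp
  next
    case False
    then have "mono_symbol l f k = (\<lambda>_. 0)"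
      by (simp add: mono_symbol_def fun_eq_iff)
    then show ?thesis
      by (simp add: separately_poly_const)
  qed
  fix m m' :: "'a \<Rightarrow>\<^sub>0 nat"
  assume "\<And>i. 1 \<le> Poly_Mapping.lookup m i"
  from P[OF this] obtain c q where cq: "P (tmono m) = cscale c (tmono q)" "expo q = expo m + l"
    "const_bipoly (c * weight_fact i0 q / weight_fact i0 m) = f (lattice_pt (expo m))"
    by blast
  have iff: "expo m' - expo m = l \<longleftrightarrow> q = m'"
  proof -
    have "expo m' - expo m = l \<longleftrightarrow> expo q = expo m'"
      unfolding cq(2) by (auto simp: algebra_simps)
    then show ?thesis
      by simp
  qed
  show "const_bipoly (entry i0 P m m') = mono_symbol l f (expo m' - expo m) (lattice_pt (expo m))"
    unfolding mono_symbol_def iff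
    using cq(3) by (cases "q = m'") (simp_all add: entry_def cq(1) lookup_single when_def)
qed

lemma is_symbol_cscale: "is_symbol i0 (cscale c) (mono_symbol 0 (\<lambda>_. const_bipoly c))"
  by (rule is_symbol_mono_symbol) (auto intro!: separately_poly_const)

text \<open>The factor \<open>x $ i + 1\<close> is the quotient of consecutive factorials from the
  rescaling, which leaves \<open>i0\<close> untouched.\<close>

lemma is_symbol_mult_t:
  "is_symbol i0 (mult_t i) (mono_symbol (axis i 1) (\<lambda>x. if i = i0 then 1 else x $ i + 1))"
proof (rule is_symbol_mono_symbol)
  show "separately_poly (\<lambda>x :: bipoly ^ 'a. if i = i0 then 1 else x $ i + 1)"
    by (cases "i = i0")
       (simp_all add: separately_poly_const separately_poly_add separately_poly_coord)
  fix m :: "'a \<Rightarrow>\<^sub>0 nat"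
  let ?q = "Poly_Mapping.single i 1 + m"
  have "mult_t i (tmono m) = cscale 1 (tmono ?q)"
    by (simp add: mult_t_single)
  moreover have "expo ?q = expo m + axis i 1"
    by (auto simp: vec_eq_iff axis_def lookup_add lookup_single when_def)
  moreover have "const_bipoly (1 * weight_fact i0 ?q / weight_fact i0 m)
      = (if i = i0 then 1 else lattice_pt (expo m) $ i + 1)"
    unfolding weight_fact_Suc by (simp add: add.commute)
  ultimately show "\<exists>c q. mult_t i (tmono m) = cscale c (tmono q) \<and> expo q = expo m + axis i 1
      \<and> const_bipoly (c * weight_fact i0 q / weight_fact i0 m)
        = (if i = i0 then 1 else lattice_pt (expo m) $ i + 1)"
    by blast
qed

lemma remove_variable:
  assumes "1 \<le> Poly_Mapping.lookup m i"
  shows "Poly_Mapping.single i 1 + (m - Poly_Mapping.single i (1 :: nat)) = m"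
  using assms by (intro poly_mapping_eqI) (auto simp: lookup_add lookup_minus lookup_single when_def)

lemma expo_remove_variable:
  assumes "1 \<le> Poly_Mapping.lookup m i"
  shows "expo (m - Poly_Mapping.single i 1) = expo m - axis i 1"
  using assms by (auto simp: vec_eq_iff axis_def lookup_minus lookup_single when_def)

text \<open>For \<open>i\<close> different from \<open>i0\<close> the exponent produced by
  differentiation cancels against the factorials.\<close>

lemma is_symbol_deriv_t:
  "is_symbol i0 (deriv_t i) (mono_symbol (- axis i 1) (\<lambda>x. if i = i0 then x $ i else 1))"
proof (rule is_symbol_mono_symbol)
  show "separately_poly (\<lambda>x :: bipoly ^ 'a. if i = i0 then x $ i else 1)"
    by (cases "i = i0") (simp_all add: separately_poly_const separately_poly_coord)
  fix m :: "'a \<Rightarrow>\<^sub>0 nat"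
  assume "\<And>i. 1 \<le> Poly_Mapping.lookup m i"
  then have m: "1 \<le> Poly_Mapping.lookup m i" .
  let ?q = "m - Poly_Mapping.single i 1"
  have "deriv_t i (tmono m) = cscale (of_nat (Poly_Mapping.lookup m i)) (tmono ?q)"
    by (intro poly_mapping_eqI) (simp add: deriv_t_mono lookup_single when_def)
  moreover have "expo ?q = expo m + - axis i 1"
    by (simp add: expo_remove_variable[OF m, simplified])
  moreover have "of_nat (Poly_Mapping.lookup m i) * weight_fact i0 ?q / weight_fact i0 m
      = (if i = i0 then of_nat (Poly_Mapping.lookup m i) else 1)"
  proof -
    have "Suc (Poly_Mapping.lookup ?q i) = Poly_Mapping.lookup m i"
      using m by (simp add: lookup_minus)
    then show ?thesis
      using weight_fact_Suc[of i0 i ?q] m unfolding remove_variable[OF m]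
      by (auto simp: field_simps)
  qed
  then have "const_bipoly (of_nat (Poly_Mapping.lookup m i) * weight_fact i0 ?q / weight_fact i0 m)
      = (if i = i0 then lattice_pt (expo m) $ i else 1)"
    by (simp del: const_bipoly_simps(4) add: const_bipoly_simps(1,2))
  ultimately show "\<exists>c q. deriv_t i (tmono m) = cscale c (tmono q) \<and> expo q = expo m + - axis i 1
      \<and> const_bipoly (c * weight_fact i0 q / weight_fact i0 m)
        = (if i = i0 then lattice_pt (expo m) $ i else 1)"
    by blast
qed

lemma ex_symbol: "P \<in> weyl \<Longrightarrow> \<exists>d. is_symbol i0 P d"
proof (induction rule: weyl.induct)
  case (comp P Q)
  then show ?case
    using is_symbol_comp linear_op_weyl by blast
qed (blast intro: is_symbol_cscale is_symbol_mult_t is_symbol_deriv_t is_symbol_add)+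

definition symbol :: "'i::finite \<Rightarrow> 'i operator \<Rightarrow> int ^ 'i \<Rightarrow> bipoly ^ 'i \<Rightarrow> bipoly" where
  "symbol i0 P = (THE d. is_symbol i0 P d)"

lemma symbol_eqI: "is_symbol i0 P d \<Longrightarrow> symbol i0 P = d"
  unfolding symbol_def by (blast intro: is_symbol_unique)

lemma is_symbol_symbol: "P \<in> weyl \<Longrightarrow> is_symbol i0 P (symbol i0 P)"
  using ex_symbol symbol_eqI by metis

lemma finite_support_symbol: "P \<in> weyl \<Longrightarrow> finite (support (symbol i0 P))"
  using is_symbol_symbol is_symbol_def by blast

lemma symbol_cscale: "symbol i0 (cscale c) = mono_symbol 0 (\<lambda>_. const_bipoly c)"
  by (rule symbol_eqI is_symbol_cscale)+

lemma symbol_add: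
  "P \<in> weyl \<Longrightarrow> Q \<in> weyl \<Longrightarrow> symbol i0 (\<lambda>p. P p + Q p) = (\<lambda>k x. symbol i0 P k x + symbol i0 Q k x)"
  by (intro symbol_eqI is_symbol_add is_symbol_symbol)

lemma symbol_comp:
  "P \<in> weyl \<Longrightarrow> Q \<in> weyl \<Longrightarrow> symbol i0 (P \<circ> Q) = symbol_comp (symbol i0 P) (symbol i0 Q)"
  by (intro symbol_eqI is_symbol_comp is_symbol_symbol linear_op_weyl)

lemma symbol_theta: "symbol i0 (theta i) = mono_symbol 0 (\<lambda>x. x $ i)"
  by (intro symbol_eqI is_symbol_mono_symbol separately_poly_coord)
     (auto simp: theta_mono)

lemma symbol_euler: "symbol i0 euler = mono_symbol 0 (\<lambda>x. \<Sum>i\<in>UNIV. x $ i)"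
proof (intro symbol_eqI is_symbol_mono_symbol separately_poly_sum separately_poly_coord)
  fix m :: "'a \<Rightarrow>\<^sub>0 nat"
  have "const_bipoly (of_nat (\<Sum>i\<in>UNIV. Poly_Mapping.lookup m i))
      = (\<Sum>i\<in>UNIV. lattice_pt (expo m) $ i)"
    by (simp add: const_bipoly_sum)
  then show "\<exists>c q. euler (tmono m) = cscale c (tmono q) \<and> expo q = expo m + 0
      \<and> const_bipoly (c * weight_fact i0 q / weight_fact i0 m) = (\<Sum>i\<in>UNIV. lattice_pt (expo m) $ i)"
    by (intro exI[of _ "of_nat (\<Sum>i\<in>UNIV. Poly_Mapping.lookup m i)"] exI[of _ m])
       (simp add: euler_mono)
qed

text \<open>The gain from the rescaling: the coefficient is 1 at every exponent, even where
  \<open>x $ j = 0\<close> and the operator kills the honest monomials. These operators therefore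
  become invertible shifts of weights.\<close>

lemma symbol_mult_deriv:
  assumes "j \<noteq> i0"
  shows "symbol i0 (mult_t i0 \<circ> deriv_t j) = mono_symbol (axis i0 1 - axis j 1) (\<lambda>_. 1)"
proof (intro symbol_eqI is_symbol_mono_symbol separately_poly_const)
  fix m :: "'a \<Rightarrow>\<^sub>0 nat"
  assume "\<And>i. 1 \<le> Poly_Mapping.lookup m i"
  then have m: "1 \<le> Poly_Mapping.lookup m j" .
  let ?r = "m - Poly_Mapping.single j 1"
  let ?q = "Poly_Mapping.single i0 1 + ?r"
  have "expo ?q = axis i0 1 + expo ?r"
    by (auto simp: vec_eq_iff axis_def lookup_add lookup_single when_def)
  then have "expo ?q = expo m + (axis i0 1 - axis j 1)"
    by (simp add: expo_remove_variable[OF m, simplified])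
  moreover have "of_nat (Poly_Mapping.lookup m j) * weight_fact i0 ?q / weight_fact i0 m = 1"
  proof -
    have "Suc (Poly_Mapping.lookup ?r j) = Poly_Mapping.lookup m j"
      using m by (simp add: lookup_minus)
    moreover have "weight_fact i0 ?q = weight_fact i0 ?r"
      by (simp only: weight_fact_Suc) simp
    ultimately show ?thesis
      using weight_fact_Suc[of i0 j ?r] assms unfolding remove_variable[OF m]
      by (metis divide_self_if weight_fact_nonzero)
  qed
  then have "const_bipoly (of_nat (Poly_Mapping.lookup m j) * weight_fact i0 ?q
      / weight_fact i0 m) = 1"
    by (simp only: const_bipoly_simps)
  ultimately show "\<exists>c q. (mult_t i0 \<circ> deriv_t j) (tmono m) = cscale c (tmono q)
      \<and> expo q = expo m + (axis i0 1 - axis j 1)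
      \<and> const_bipoly (c * weight_fact i0 q / weight_fact i0 m) = 1"
    using mult_deriv_mono[of i0 j m] by (intro exI conjI)
qed

text \<open>In degree \<open>k\<close>, commuting with \<open>euler\<close> equates
  \<open>e(x)\<close> and \<open>e(x + k)\<close> times the same coefficient, where \<open>e\<close>
  is the coordinate sum. A nonzero coefficient can be cancelled in a domain, and characteristic zero
  leaves that the entries of \<open>k\<close> sum to 0.\<close>

lemma support_symbol_centralizer:
  assumes P: "P \<in> weyl_centralizer" and k: "k \<in> support (symbol i0 P)"
  shows "(\<Sum>i\<in>UNIV. k $ i) = 0"
proof -
  have W: "P \<in> weyl" and comm: "P \<circ> euler = euler \<circ> P"
    using P by (auto simp: weyl_centralizer_def)
  let ?e = "\<lambda>x :: bipoly ^ 'a. \<Sum>i\<in>UNIV. x $ i"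
  let ?E = "mono_symbol 0 ?e :: int ^ 'a \<Rightarrow> _"
  obtain x where x: "symbol i0 P k x \<noteq> 0"
    using k by (auto simp: support_def)
  have fin: "finite (support (symbol i0 P))"
    by (rule finite_support_symbol[OF W])
  have h1: "symbol_comp (symbol i0 P) ?E k x = symbol i0 P k x * ?e x"
  proof -
    have "symbol_comp (symbol i0 P) ?E k x
        = (\<Sum>l\<in>{0}. symbol i0 P (k - l) (x + lattice_pt l) * ?E l x)"
      unfolding symbol_comp_def
      by (rule sum.mono_neutral_left)
         (use support_mono_symbol in \<open>auto simp: not_in_support\<close>)
    moreover have "x + lattice_pt 0 = x"
      by (simp add: vec_eq_iff)
    ultimately show ?thesis
      by (simp add: mono_symbol_def)
  qed
  have h2: "symbol_comp ?E (symbol i0 P) k x = ?e (x + lattice_pt k) * symbol i0 P k x"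
  proof -
    have "symbol_comp ?E (symbol i0 P) k x
        = (\<Sum>l\<in>{k}. ?E (k - l) (x + lattice_pt l) * symbol i0 P l x)"
      unfolding symbol_comp_def using fin k
      by (intro sum.mono_neutral_right) (auto simp: mono_symbol_def)
    then show ?thesis
      by (simp add: mono_symbol_def)
  qed
  have h3: "symbol_comp (symbol i0 P) ?E = symbol_comp ?E (symbol i0 P)"
    using symbol_comp[OF W euler_in_weyl, of i0] symbol_comp[OF euler_in_weyl W, of i0]
    unfolding comm symbol_euler by (rule trans[OF sym])
  have "symbol i0 P k x * ?e x = ?e (x + lattice_pt k) * symbol i0 P k x"
    unfolding h1[symmetric] h2[symmetric] h3 ..
  then have "?e x = ?e (x + lattice_pt k)"
    using x by simp
  then have "of_int (\<Sum>i\<in>UNIV. k $ i) = (0 :: bipoly)"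
    by (simp add: sum.distrib)
  then show ?thesis
    by (simp only: of_int_eq_0_iff)
qed

section \<open>Jets acting on four copies of a module over the free algebra\<close>

lemma free2D:
  assumes "M \<in> free2_fd_modules"
  shows free2_subspace: "cvs.subspace (rep_space M)"
    and free2_closed: "x \<in> rep_space M \<Longrightarrow> rep_act M b x \<in> rep_space M"
    and free2_add: "x \<in> rep_space M \<Longrightarrow> y \<in> rep_space M \<Longrightarrow>
      rep_act M b (x + y) = rep_act M b x + rep_act M b y"
    and free2_scale: "x \<in> rep_space M \<Longrightarrow> rep_act M b (cscale c x) = cscale c (rep_act M b x)"
  using assms by (auto simp: free2_fd_modules_def linear_between_def)

lemma subspace_closed:
  assumes "cvs.subspace U"
  shows "0 \<in> U" "x \<in> U \<Longrightarrow> y \<in> U \<Longrightarrow> x + y \<in> U" "x \<in> U \<Longrightarrow> cscale c x \<in> U"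
    "x \<in> U \<Longrightarrow> y \<in> U \<Longrightarrow> x - y \<in> U" "(\<And>s. s \<in> S \<Longrightarrow> f s \<in> U) \<Longrightarrow> sum f S \<in> U"
  using assms
  by (auto simp: cvs.subspace_0 cvs.subspace_add cvs.subspace_scale cvs.subspace_diff
      intro: cvs.subspace_sum)

lemma free2_zero: "M \<in> free2_fd_modules \<Longrightarrow> rep_act M b 0 = 0"
  using free2_scale[of M 0 b 0] subspace_closed(1)[OF free2_subspace] by simp

datatype layer = Top | MidX | MidY | Bot

instance layer :: countable
  by countable_datatype

lemma UNIV_layer: "UNIV = {Top, MidX, MidY, Bot}"
  using layer.exhaust by auto

instance layer :: finite
  by standard (simp add: UNIV_layer)

type_synonym slots = "layer \<Rightarrow> vec"

text \<open>On \<open>U\<^sup>4\<close> the commuting variables \<open>X\<close> and \<open>Y\<close> map the top copy identically to the copies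
  \<open>MidX\<close> and \<open>MidY\<close>, and they act from these to the bottom copy such that \<open>X\<^sup>2\<close>, \<open>X Y\<close> and
  \<open>Y\<^sup>2\<close> act from top to bottom as \<open>1\<close>, \<open>A\<close> and \<open>B\<close>, where \<open>A\<close> and \<open>B\<close> generate the action of the
  free algebra. Hence only the 2-jet of a polynomial matters.\<close>

primrec jet :: "bool rep \<Rightarrow> bipoly \<Rightarrow> slots \<Rightarrow> slots" where
  "jet M q v Top = cscale (coeff (coeff q 0) 0) (v Top)"
| "jet M q v MidX = cscale (coeff (coeff q 0) 0) (v MidX) + cscale (coeff (coeff q 1) 0) (v Top)"
| "jet M q v MidY = cscale (coeff (coeff q 0) 0) (v MidY) + cscale (coeff (coeff q 0) 1) (v Top)"
| "jet M q v Bot = cscale (coeff (coeff q 0) 0) (v Bot)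
     + (cscale (coeff (coeff q 1) 0) (v MidX + rep_act M False (v MidY))
      + cscale (coeff (coeff q 0) 1) (rep_act M False (v MidX) + rep_act M True (v MidY))
      + cscale (coeff (coeff q 2) 0) (v Top)
      + cscale (coeff (coeff q 1) 1) (rep_act M False (v Top))
      + cscale (coeff (coeff q 0) 2) (rep_act M True (v Top)))"

declare jet.simps [simp del]

lemma slots_eqI:
  assumes "v Top = w Top" "v MidX = w MidX" "v MidY = w MidY" "v Bot = w Bot"
  shows "v = w"
proof
  fix r
  show "v r = w r"
    using assms by (cases r) simp_all
qed

lemma jet_closed:
  assumes "M \<in> free2_fd_modules" "\<And>r. v r \<in> rep_space M"
  shows "jet M q v r \<in> rep_space M"
  using assms
  by (cases r)
     (auto simp: jet.simps intro!: subspace_closed(2,3)[OF free2_subspace[OF assms(1)]] free2_closed)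

lemma jet_add_poly: "jet M (q + q') v r = jet M q v r + jet M q' v r"
proof -
  have "jet M (q + q') v = (\<lambda>r. jet M q v r + jet M q' v r)"
    by (rule slots_eqI) (simp_all add: jet.simps cvs.scale_left_distrib)
  then show ?thesis
    by simp
qed

lemma jet_zero_poly [simp]: "jet M 0 v r = 0"
proof -
  have "jet M 0 v = (\<lambda>r. 0)"
    by (rule slots_eqI) (simp_all add: jet.simps)
  then show ?thesis
    by simp
qed

lemma jet_sum_poly: "jet M (sum f S) v r = (\<Sum>s\<in>S. jet M (f s) v r)"
  by (induction S rule: infinite_finite_induct) (auto simp: jet_add_poly)

lemma jet_const [simp]: "jet M (const_bipoly c) v r = cscale c (v r)"
proof -
  have "jet M (const_bipoly c) v = (\<lambda>r. cscale c (v r))"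
    by (rule slots_eqI) (simp_all add: jet.simps const_bipoly_def coeff_pCons split: nat.split)
  then show ?thesis
    by simp
qed

lemma jet_one [simp]: "jet M 1 v r = v r"
  using jet_const[of M 1 v r] by simp

lemma jet_add:
  assumes "M \<in> free2_fd_modules" "\<And>r. v r \<in> rep_space M" "\<And>r. w r \<in> rep_space M"
  shows "jet M q (\<lambda>r. v r + w r) r = jet M q v r + jet M q w r"
proof -
  have "jet M q (\<lambda>r. v r + w r) = (\<lambda>r. jet M q v r + jet M q w r)"
    by (rule slots_eqI) (simp_all add: jet.simps free2_add assms cvs.scale_right_distrib)
  then show ?thesis
    by simp
qed

lemma jet_scale:
  assumes "M \<in> free2_fd_modules" "\<And>r. v r \<in> rep_space M"
  shows "jet M q (\<lambda>r. cscale c (v r)) r = cscale c (jet M q v r)"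
proof -
  have "jet M q (\<lambda>r. cscale c (v r)) = (\<lambda>r. cscale c (jet M q v r))"
    by (rule slots_eqI)
       (simp_all add: jet.simps free2_scale assms cvs.scale_right_distrib mult.commute)
  then show ?thesis
    by simp
qed

lemma jet_zero [simp]:
  assumes "M \<in> free2_fd_modules"
  shows "jet M q (\<lambda>r. 0) r = 0"
  using jet_scale[OF assms, of "\<lambda>r. 0" q 0] subspace_closed(1)[OF free2_subspace[OF assms]] by simp

lemma jet_sum:
  assumes "M \<in> free2_fd_modules" "\<And>s r. s \<in> S \<Longrightarrow> v s r \<in> rep_space M"
  shows "jet M q (\<lambda>r. \<Sum>s\<in>S. v s r) r = (\<Sum>s\<in>S. jet M q (v s) r)"
  using assms(2)
proof (induction S rule: infinite_finite_induct)
  case (insert s S)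
  have "jet M q (\<lambda>r. v s r + (\<Sum>s\<in>S. v s r)) r
      = jet M q (v s) r + jet M q (\<lambda>r. \<Sum>s\<in>S. v s r) r"
    using insert.prems by (intro jet_add assms(1) subspace_closed(5)[OF free2_subspace]) auto
  with insert show ?case
    by simp
qed (simp_all add: assms(1))

text \<open>\<open>X\<close> and \<open>Y\<close> commute because both ways from \<open>Top\<close>
  to \<open>Bot\<close> through the two middle layers give \<open>A\<close>; products of three
  variables vanish, so the Cauchy product is needed only up to degree two.\<close>

lemma jet_mult:
  assumes M: "M \<in> free2_fd_modules" and v: "\<And>r. v r \<in> rep_space M"
  shows "jet M (q * q') v = jet M q (jet M q' v)"
proof (rule slots_eqI)
  note closed = subspace_closed(2,3)[OF free2_subspace[OF M]] free2_closed[OF M]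
  note coeffs = coeff_mult coeff_sum numeral_2_eq_2
  note linear = free2_add[OF M] free2_scale[OF M]
  show "jet M (q * q') v Top = jet M q (jet M q' v) Top"
    by (simp add: jet.simps coeffs)
  show "jet M (q * q') v MidX = jet M q (jet M q' v) MidX"
    by (simp add: jet.simps coeffs cvs.scale_left_distrib cvs.scale_right_distrib)
  show "jet M (q * q') v MidY = jet M q (jet M q' v) MidY"
    by (simp add: jet.simps coeffs cvs.scale_left_distrib cvs.scale_right_distrib)
  show "jet M (q * q') v Bot = jet M q (jet M q' v) Bot"
    by (simp add: jet.simps coeffs linear closed v cvs.scale_left_distrib cvs.scale_right_distrib
        add_ac)
qed

text \<open>Without constant term, \<open>q\<close> lowers every vector by at least one of the three
  levels top, middle, bottom.\<close>

lemma jet_cube_zero: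
  assumes M: "M \<in> free2_fd_modules" and v: "\<And>r. v r \<in> rep_space M"
    and q: "coeff (coeff q 0) 0 = 0"
  shows "jet M (q ^ 3) v = (\<lambda>r. 0)"
proof -
  have "jet M (q ^ 3) v = jet M q (jet M q (jet M q v))"
    by (simp add: power3_eq_cube jet_mult[OF M] jet_closed[OF M] v)
  also have "\<dots> = (\<lambda>r. 0)"
    by (rule slots_eqI) (simp_all add: jet.simps q free2_zero[OF M])
  finally show ?thesis .
qed

text \<open>The action is triangular with the constant coefficient on the diagonal, so the
  components vanish successively from the top downwards.\<close>

lemma jet_eq_zeroD:
  assumes M: "M \<in> free2_fd_modules" and q: "coeff (coeff q 0) 0 \<noteq> 0"
    and zero: "\<And>r. jet M q v r = 0"
  shows "v = (\<lambda>r. 0)"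
proof -
  have scale: "cscale (coeff (coeff q 0) 0) x = 0 \<Longrightarrow> x = 0" for x :: vec
    using q cvs.scale_eq_0_iff by blast
  have "v Top = 0"
    using zero[of Top] by (simp add: jet.simps scale)
  moreover from this have "v MidX = 0" "v MidY = 0"
    using zero[of MidX] zero[of MidY]
    by (simp_all add: jet.simps scale)
  moreover from calculation have "v Bot = 0"
    using zero[of Bot] by (simp add: jet.simps free2_zero[OF M] scale)
  ultimately show ?thesis
    by (intro slots_eqI) auto
qed

lemma constant_coeff_power: "coeff (coeff (q ^ N) 0) 0 = (coeff (coeff q 0) 0 :: 'a::comm_semiring_1) ^ N"
  by (simp add: coeff_0_power)

section \<open>The functor on objects\<close>

locale lattice_functor =
  fixes i0 i1 :: "'i::finite" and a :: int
  assumes distinct: "i0 \<noteq> i1"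
begin

text \<open>In \<open>bipoly\<close>, the outer variable stands for \<open>X\<close> and the inner one for \<open>Y\<close>.\<close>

definition point :: "int ^ 'i \<Rightarrow> bipoly ^ 'i" where
  "point \<mu> = lattice_pt \<mu> + (\<chi> i. if i = i0 then [:0, 1:] else if i = i1 then [:[:0, 1:]:] else 0)"

definition at_weight :: "int ^ 'i \<Rightarrow> vec \<Rightarrow> slots" where
  "at_weight \<mu> w = (\<lambda>r. slot (\<mu>, r) w)"

text \<open>Each summand is the contribution arriving at \<open>\<nu>\<close> by the shift
  \<open>k\<close>; as in \<open>is_symbol\<close>, its coefficient is evaluated at the source
  weight.\<close>

definition act :: "bool rep \<Rightarrow> 'i operator \<Rightarrow> vec \<Rightarrow> vec" where
  "act M P w = assemble (\<lambda>(\<nu>, r). \<Sum>k\<in>support (symbol i0 P).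
     jet M (symbol i0 P k (point (\<nu> - k))) (at_weight (\<nu> - k) w) r)"

definition lattice_space :: "bool rep \<Rightarrow> vec set" where
  "lattice_space M = {w. \<forall>\<mu> r. at_weight \<mu> w r \<in> rep_space M
     \<and> ((\<Sum>i\<in>UNIV. \<mu> $ i) \<noteq> a \<longrightarrow> at_weight \<mu> w r = 0)}"

definition lattice_rep :: "bool rep \<Rightarrow> 'i operator rep" where
  "lattice_rep M = \<lparr>rep_space = lattice_space M, rep_act = act M\<rparr>"

definition place :: "int ^ 'i \<Rightarrow> slots \<Rightarrow> vec" where
  "place \<mu> v = assemble (\<lambda>(\<nu>, r). if \<nu> = \<mu> then v r else 0)"

lemma rep_sel [simp]:
  "rep_space (lattice_rep M) = lattice_space M" "rep_act (lattice_rep M) = act M"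
  by (simp_all add: lattice_rep_def)

lemma weight_eqI:
  assumes "\<And>\<mu> r. at_weight \<mu> v r = at_weight \<mu> w r"
  shows "v = w"
proof (rule slot_eqI)
  fix b :: "(int ^ 'i) \<times> layer"
  show "slot b v = slot b w"
    using assms[of "fst b" "snd b"] by (simp add: at_weight_def)
qed

lemma at_weight_simps [simp]:
  "at_weight \<mu> (v + w) r = at_weight \<mu> v r + at_weight \<mu> w r"
  "at_weight \<mu> (v - w) r = at_weight \<mu> v r - at_weight \<mu> w r"
  "at_weight \<mu> 0 r = 0"
  "at_weight \<mu> (cscale c w) r = cscale c (at_weight \<mu> w r)"
  "at_weight \<mu> (sum f S) r = (\<Sum>s\<in>S. at_weight \<mu> (f s) r)"
  by (simp_all add: at_weight_def)

lemma finite_weights: "finite {\<mu>. \<exists>r. at_weight \<mu> w r \<noteq> 0}"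
proof (rule finite_subset)
  show "{\<mu>. \<exists>r. at_weight \<mu> w r \<noteq> 0} \<subseteq> fst ` {b :: _ \<times> layer. slot b w \<noteq> 0}"
  proof
    fix \<mu>
    assume "\<mu> \<in> {\<mu>. \<exists>r. at_weight \<mu> w r \<noteq> 0}"
    then have "\<exists>r. at_weight \<mu> w r \<noteq> 0"
      by simp
    then obtain r where "at_weight \<mu> w r \<noteq> 0" ..
    then show "\<mu> \<in> fst ` {b :: _ \<times> layer. slot b w \<noteq> 0}"
      by (intro rev_image_eqI[of "(\<mu>, r)"]) (simp_all add: at_weight_def)
  qed
qed (simp add: finite_slots)

lemma at_weight_assemble:
  fixes G :: "int ^ 'i \<Rightarrow> slots"
  assumes "finite {\<mu>. \<exists>r. G \<mu> r \<noteq> 0}"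
  shows "at_weight \<mu> (assemble (\<lambda>(\<mu>, r). G \<mu> r)) r = G \<mu> r"
proof -
  have "finite {b. (\<lambda>(\<mu>, r). G \<mu> r) b \<noteq> 0}"
  proof (rule finite_subset)
    show "{b. (\<lambda>(\<mu>, r). G \<mu> r) b \<noteq> 0} \<subseteq> {\<mu>. \<exists>r. G \<mu> r \<noteq> 0} \<times> UNIV"
      by auto
  qed (use assms in auto)
  from slot_assemble[OF this] show ?thesis
    by (simp add: at_weight_def)
qed

lemma at_weight_place: "at_weight \<nu> (place \<mu> v) r = (if \<nu> = \<mu> then v r else 0)"
  unfolding place_def
  by (rule at_weight_assemble) (rule finite_subset[of _ "{\<mu>}"], auto split: if_splits)

lemma at_weight_place_same [simp]: "at_weight \<mu> (place \<mu> v) = v"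
  by (rule ext) (simp add: at_weight_place)

lemma lattice_spaceD:
  assumes "w \<in> lattice_space M"
  shows "at_weight \<mu> w r \<in> rep_space M"
    and "(\<Sum>i\<in>UNIV. \<mu> $ i) \<noteq> a \<Longrightarrow> at_weight \<mu> w r = 0"
  using assms by (auto simp: lattice_space_def)

lemma subspace_lattice_space:
  assumes "M \<in> free2_fd_modules"
  shows "cvs.subspace (lattice_space M)"
  using subspace_closed[OF free2_subspace[OF assms]]
  by (auto simp: cvs.subspace_def lattice_space_def)

lemma place_in_lattice_space:
  assumes "M \<in> free2_fd_modules" "(\<Sum>i\<in>UNIV. \<mu> $ i) = a" "\<And>r. v r \<in> rep_space M"
  shows "place \<mu> v \<in> lattice_space M"
  using assms subspace_closed(1)[OF free2_subspace]
  by (auto simp: lattice_space_def at_weight_place)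

lemma place_sum:
  "w = (\<Sum>\<mu> | \<exists>r. at_weight \<mu> w r \<noteq> 0. place \<mu> (at_weight \<mu> w))"
proof (rule weight_eqI)
  fix \<nu> r
  have "(\<Sum>\<mu> | \<exists>r. at_weight \<mu> w r \<noteq> 0. at_weight \<nu> (place \<mu> (at_weight \<mu> w)) r)
      = (\<Sum>\<mu> | \<exists>r. at_weight \<mu> w r \<noteq> 0. if \<nu> = \<mu> then at_weight \<nu> w r else 0)"
    by (rule sum.cong) (auto simp: at_weight_place)
  also have "\<dots> = at_weight \<nu> w r"
    using finite_weights[of w] by (auto simp: sum.delta)
  finally show "at_weight \<nu> w r
      = at_weight \<nu> (\<Sum>\<mu> | \<exists>r. at_weight \<mu> w r \<noteq> 0. place \<mu> (at_weight \<mu> w)) r"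
    by simp
qed

text \<open>The nilpotent perturbation is the same at all weights, so the evaluation point moves by
  exactly the shift, as \<open>symbol_comp\<close> demands.\<close>

lemma point_add: "point (\<mu> + k) = point \<mu> + lattice_pt k"
  by (simp add: point_def lattice_pt_add)

text \<open>The freedom in \<open>S\<close> lets several operators be compared over one index set.
  The result of \<open>act\<close> is finitely supported because its weights lie in the sumset of
  the weights of \<open>w\<close> and the support of the symbol.\<close>

lemma at_weight_act:
  assumes M: "M \<in> free2_fd_modules" and P: "P \<in> weyl"
    and S: "finite S" "support (symbol i0 P) \<subseteq> S"
  shows "at_weight \<nu> (act M P w) r
     = (\<Sum>k\<in>S. jet M (symbol i0 P k (point (\<nu> - k))) (at_weight (\<nu> - k) w) r)"
proof -
  let ?d = "symbol i0 P" and ?W = "{\<mu>. \<exists>r. at_weight \<mu> w r \<noteq> 0}"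
  let ?G = "\<lambda>\<nu> r. \<Sum>k\<in>support ?d. jet M (?d k (point (\<nu> - k))) (at_weight (\<nu> - k) w) r"
  have fin: "finite (support ?d)"
    by (rule finite_support_symbol[OF P])
  have "{\<nu>. \<exists>r. ?G \<nu> r \<noteq> 0} \<subseteq> (\<lambda>(\<mu>, k). \<mu> + k) ` (?W \<times> support ?d)"
  proof
    fix \<nu>
    assume "\<nu> \<in> {\<nu>. \<exists>r. ?G \<nu> r \<noteq> 0}"
    then obtain r k where k: "k \<in> support ?d"
      and nz: "jet M (?d k (point (\<nu> - k))) (at_weight (\<nu> - k) w) r \<noteq> 0"
      by (auto elim: sum.not_neutral_contains_not_neutral)
    have "\<nu> - k \<in> ?W"
    proof (rule ccontr)
      assume "\<nu> - k \<notin> ?W"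
      then have "at_weight (\<nu> - k) w = (\<lambda>r. 0)"
        by auto
      with nz show False
        by (simp add: M)
    qed
    with k show "\<nu> \<in> (\<lambda>(\<mu>, k). \<mu> + k) ` (?W \<times> support ?d)"
      by (intro rev_image_eqI[of "(\<nu> - k, k)"]) auto
  qed
  then have "finite {\<nu>. \<exists>r. ?G \<nu> r \<noteq> 0}"
    by (rule finite_subset) (use fin finite_weights in auto)
  then have "at_weight \<nu> (act M P w) r = ?G \<nu> r"
    unfolding act_def by (rule at_weight_assemble)
  also have "\<dots> = (\<Sum>k\<in>S. jet M (?d k (point (\<nu> - k))) (at_weight (\<nu> - k) w) r)"
    using S by (intro sum.mono_neutral_left) (auto simp: not_in_support)
  finally show ?thesis .
qed

lemma at_weight_act_mono_symbol:
  assumes "M \<in> free2_fd_modules" "P \<in> weyl" "symbol i0 P = mono_symbol l f"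
  shows "at_weight \<nu> (act M P w) r = jet M (f (point (\<nu> - l))) (at_weight (\<nu> - l) w) r"
  using at_weight_act[OF assms(1,2), of "{l}"] support_mono_symbol[of l f] assms(3)
  by (simp add: mono_symbol_def)

lemma act_closed:
  assumes M: "M \<in> free2_fd_modules" and P: "P \<in> weyl_centralizer" and w: "w \<in> lattice_space M"
  shows "act M P w \<in> lattice_space M"
  unfolding lattice_space_def
proof (intro CollectI allI conjI impI)
  fix \<mu> r
  have W: "P \<in> weyl"
    using P by (simp add: weyl_centralizer_def)
  note act = at_weight_act[OF M W finite_support_symbol[OF W] order_refl]
  show "at_weight \<mu> (act M P w) r \<in> rep_space M"
    unfolding act
    by (intro subspace_closed(5)[OF free2_subspace[OF M]] jet_closed M lattice_spaceD(1)[OF w])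
  assume \<mu>: "(\<Sum>i\<in>UNIV. \<mu> $ i) \<noteq> a"
  show "at_weight \<mu> (act M P w) r = 0"
    unfolding act
  proof (rule sum.neutral, rule ballI)
    fix k
    assume "k \<in> support (symbol i0 P)"
    then have "(\<Sum>i\<in>UNIV. (\<mu> - k) $ i) \<noteq> a"
      using \<mu> support_symbol_centralizer[OF P] by (simp add: sum_subtractf)
    then have "at_weight (\<mu> - k) w = (\<lambda>r. 0)"
      using lattice_spaceD(2)[OF w] by auto
    then show "jet M (symbol i0 P k (point (\<mu> - k))) (at_weight (\<mu> - k) w) r = 0"
      by (simp add: M)
  qed
qed

lemma act_linear:
  assumes M: "M \<in> free2_fd_modules" and P: "P \<in> weyl"
    and v: "v \<in> lattice_space M" and w: "w \<in> lattice_space M"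
  shows "act M P (v + w) = act M P v + act M P w" "act M P (cscale c v) = cscale c (act M P v)"
proof -
  note act = at_weight_act[OF M P finite_support_symbol[OF P] order_refl]
  have add: "at_weight \<mu> (v + w) = (\<lambda>r. at_weight \<mu> v r + at_weight \<mu> w r)"
    and scale: "at_weight \<mu> (cscale c v) = (\<lambda>r. cscale c (at_weight \<mu> v r))" for \<mu>
    by auto
  show "act M P (v + w) = act M P v + act M P w"
    by (rule weight_eqI)
       (simp add: act add jet_add[OF M] lattice_spaceD(1)[OF v] lattice_spaceD(1)[OF w] sum.distrib)
  show "act M P (cscale c v) = cscale c (act M P v)"
    by (rule weight_eqI)
       (simp add: act scale jet_scale[OF M] lattice_spaceD(1)[OF v] cvs.scale_sum_right)
qed

lemma act_add:
  assumes M: "M \<in> free2_fd_modules" and P: "P \<in> weyl" and Q: "Q \<in> weyl"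
  shows "act M (\<lambda>p. P p + Q p) w = act M P w + act M Q w"
proof (rule weight_eqI)
  fix \<mu> r
  let ?S = "support (symbol i0 P) \<union> support (symbol i0 Q)"
  have fin: "finite ?S"
    by (simp add: finite_support_symbol P Q)
  have sub: "support (symbol i0 (\<lambda>p. P p + Q p)) \<subseteq> ?S"
    unfolding symbol_add[OF P Q] by (auto simp: support_def)
  show "at_weight \<mu> (act M (\<lambda>p. P p + Q p) w) r = at_weight \<mu> (act M P w + act M Q w) r"
    by (simp add: at_weight_act[OF M weyl.add[OF P Q] fin sub] at_weight_act[OF M P fin]
        at_weight_act[OF M Q fin] symbol_add[OF P Q] jet_add_poly sum.distrib)
qed

lemma act_comp:
  assumes M: "M \<in> free2_fd_modules" and P: "P \<in> weyl" and Q: "Q \<in> weyl"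
    and w: "w \<in> lattice_space M"
  shows "act M (P \<circ> Q) w = act M P (act M Q w)"
proof (rule weight_eqI)
  fix \<nu> r
  let ?d = "symbol i0 P" and ?e = "symbol i0 Q"
  \<comment> \<open>All total shifts of a shift by \<open>Q\<close> followed by one by
    \<open>P\<close>; the composition may use fewer because of cancellation, but this set can be
    reindexed by pairs.\<close>
  let ?K = "(\<lambda>(k, l). k + l) ` (support ?d \<times> support ?e)"
  have fin: "finite (support ?d)" "finite (support ?e)"
    by (simp_all add: finite_support_symbol P Q)
  note jet_in = jet_closed[OF M lattice_spaceD(1)[OF w]]
  let ?t = "\<lambda>k l. jet M (?d (k - l) (point (\<nu> - k) + lattice_pt l) * ?e l (point (\<nu> - k)))
      (at_weight (\<nu> - k) w) r"
  have reindex: "(\<Sum>k\<in>?K. ?t k l) = (\<Sum>k\<in>support ?d. ?t (k + l) l)" if l: "l \<in> support ?e" for l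
  proof -
    have "(\<Sum>k\<in>?K. ?t k l) = (\<Sum>k\<in>(\<lambda>k. k + l) ` support ?d. ?t k l)"
    proof (rule sum.mono_neutral_right)
      show "\<forall>k\<in>?K - (\<lambda>k. k + l) ` support ?d. ?t k l = 0"
      proof
        fix k
        assume "k \<in> ?K - (\<lambda>k. k + l) ` support ?d"
        then have "k - l \<notin> support ?d"
          by (metis Diff_iff diff_add_cancel image_eqI)
        then show "?t k l = 0"
          by (simp add: not_in_support)
      qed
    qed (use fin l in auto)
    then show ?thesis
      by (simp add: sum.reindex inj_on_def)
  qed
  have "at_weight \<nu> (act M (P \<circ> Q) w) r = (\<Sum>k\<in>?K. \<Sum>l\<in>support ?e. ?t k l)"
    using support_symbol_comp[of ?d ?e] fin
    by (subst at_weight_act[OF M weyl.comp[OF P Q], of ?K])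
       (simp_all add: symbol_comp[OF P Q] symbol_comp_def jet_sum_poly)
  also have "\<dots> = (\<Sum>l\<in>support ?e. \<Sum>k\<in>support ?d. ?t (k + l) l)"
    by (subst sum.swap) (simp add: reindex)
  also have "\<dots> = (\<Sum>k\<in>support ?d. \<Sum>l\<in>support ?e. ?t (k + l) l)"
    by (rule sum.swap)
  also have "\<dots> = (\<Sum>k\<in>support ?d. jet M (?d k (point (\<nu> - k)))
      (\<lambda>r. \<Sum>l\<in>support ?e. jet M (?e l (point (\<nu> - k - l))) (at_weight (\<nu> - k - l) w) r) r)"
  proof (rule sum.cong)
    fix k
    have weight: "\<nu> - (k + l) = \<nu> - k - l" for l
      by simp
    have point: "point (\<nu> - k - l) + lattice_pt l = point (\<nu> - k)" for l
      by (simp add: point_add[symmetric])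
    show "(\<Sum>l\<in>support ?e. ?t (k + l) l) = jet M (?d k (point (\<nu> - k)))
      (\<lambda>r. \<Sum>l\<in>support ?e. jet M (?e l (point (\<nu> - k - l))) (at_weight (\<nu> - k - l) w) r) r"
      by (simp only: weight point add_diff_cancel_right' jet_sum[OF M jet_in]
          jet_mult[OF M lattice_spaceD(1)[OF w]])
  qed simp
  also have "\<dots> = at_weight \<nu> (act M P (act M Q w)) r"
    unfolding at_weight_act[OF M P fin(1) order_refl]
    by (rule sum.cong) (simp_all add: at_weight_act[OF M Q fin(2) order_refl, abs_def] at_weight_def[symmetric])
  finally show "at_weight \<nu> (act M (P \<circ> Q) w) r = at_weight \<nu> (act M P (act M Q w)) r" .
qed

lemma act_cscale:
  assumes "M \<in> free2_fd_modules"
  shows "act M (cscale c) w = cscale c w"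
  by (rule weight_eqI) (simp add: at_weight_act_mono_symbol[OF assms weyl.scalar symbol_cscale])

lemma operator_module_lattice_rep:
  assumes M: "M \<in> free2_fd_modules"
  shows "operator_module weyl_centralizer (lattice_rep M)"
proof -
  have "P \<in> weyl" if "P \<in> weyl_centralizer" for P :: "'i operator"
    using that by (simp add: weyl_centralizer_def)
  then show ?thesis
    unfolding operator_module_def linear_between_def
    by (auto simp: subspace_lattice_space[OF M] act_closed[OF M] act_linear[OF M] act_add[OF M]
        act_comp[OF M] act_cscale[OF M])
qed

section \<open>Weight spaces of the constructed module\<close>

definition cweight :: "int ^ 'i \<Rightarrow> complex ^ 'i" where
  "cweight \<mu> = (\<chi> i. of_int (\<mu> $ i))"

lemma const_bipoly_of_int: "const_bipoly (of_int z) = of_int z"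
proof -
  have "const_bipoly (- c) = - const_bipoly c" for c
    by (simp add: const_bipoly_def)
  then show ?thesis
    by (cases z) (simp_all del: of_nat_Suc)
qed

text \<open>An operator with zero shift acts on each weight component through one polynomial, so
  iteration reduces to powers in \<open>bipoly\<close>.\<close>

lemma diagonal_power:
  assumes M: "M \<in> free2_fd_modules" and P: "P \<in> weyl_centralizer"
    and symbol: "symbol i0 P = mono_symbol 0 f" and w: "w \<in> lattice_space M"
  shows "((\<lambda>x. act M P x - cscale c x) ^^ N) w \<in> lattice_space M"
    and "at_weight \<mu> (((\<lambda>x. act M P x - cscale c x) ^^ N) w)
       = jet M ((f (point \<mu>) - const_bipoly c) ^ N) (at_weight \<mu> w)"
proof (induction N)
  case 0
  show "((\<lambda>x. act M P x - cscale c x) ^^ 0) w \<in> lattice_space M"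
    using w by simp
  show "at_weight \<mu> (((\<lambda>x. act M P x - cscale c x) ^^ 0) w)
       = jet M ((f (point \<mu>) - const_bipoly c) ^ 0) (at_weight \<mu> w)"
    by (rule ext) simp
next
  case (Suc N)
  let ?T = "\<lambda>x. act M P x - cscale c x" and ?q = "f (point \<mu>) - const_bipoly c"
  note space = subspace_closed(3,4)[OF subspace_lattice_space[OF M]]
  show "(?T ^^ Suc N) w \<in> lattice_space M"
    using Suc.IH(1) by (simp add: space act_closed[OF M P])
  have W: "P \<in> weyl"
    using P by (simp add: weyl_centralizer_def)
  have "at_weight \<mu> (?T x) = jet M ?q (at_weight \<mu> x)" for x
  proof
    fix r
    have "jet M (f (point \<mu>)) (at_weight \<mu> x) r
        = jet M (?q + const_bipoly c) (at_weight \<mu> x) r"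
      by simp
    also have "\<dots> = jet M ?q (at_weight \<mu> x) r + cscale c (at_weight \<mu> x r)"
      by (simp only: jet_add_poly jet_const)
    finally show "at_weight \<mu> (?T x) r = jet M ?q (at_weight \<mu> x) r"
      by (simp add: at_weight_act_mono_symbol[OF M W symbol])
  qed
  then show "at_weight \<mu> ((?T ^^ Suc N) w) = jet M (?q ^ Suc N) (at_weight \<mu> w)"
    using Suc.IH(2) by (simp add: jet_mult[OF M lattice_spaceD(1)[OF w]])
qed

lemma constant_coeff_const_bipoly: "coeff (coeff (const_bipoly c) 0) 0 = c"
  by (simp add: const_bipoly_def)

lemma constant_coeff_point: "coeff (coeff (point \<mu> $ i) 0) 0 = of_int (\<mu> $ i)"
proof -
  have "coeff (coeff (of_int z :: bipoly) 0) 0 = of_int z" for z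
    using constant_coeff_const_bipoly[of "of_int z"] by (simp add: const_bipoly_of_int)
  then show ?thesis
    by (simp add: point_def)
qed

text \<open>On the component at \<open>\<nu>\<close> the operator \<open>theta i - mu_i\<close> has
  constant coefficient \<open>nu_i - mu_i\<close>: if this is nonzero its powers are injective
  there, and if it is zero the operator is nilpotent.\<close>

lemma weight_space_lattice_rep:
  assumes M: "M \<in> free2_fd_modules"
  shows "weight_space (lattice_rep M) \<mu>
     = {w \<in> lattice_space M. \<forall>\<nu> r. cweight \<nu> \<noteq> \<mu> \<longrightarrow> at_weight \<nu> w r = 0}"
proof (intro set_eqI iffI)
  fix w
  let ?T = "\<lambda>i x. act M (theta i) x - cscale (\<mu> $ i) x"
  note power = diagonal_power[OF M theta_in_centralizer symbol_theta]
  {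
    assume "w \<in> weight_space (lattice_rep M) \<mu>"
    then obtain N where w: "w \<in> lattice_space M" and N: "\<And>i. (?T i ^^ N) w = 0"
      by (auto simp: weight_space_def)
    have "at_weight \<nu> w = (\<lambda>r. 0)" if \<nu>: "cweight \<nu> \<noteq> \<mu>" for \<nu>
    proof -
      obtain i where i: "of_int (\<nu> $ i) \<noteq> \<mu> $ i"
        using \<nu> by (auto simp: cweight_def vec_eq_iff)
      show ?thesis
      proof (rule jet_eq_zeroD[OF M])
        show "coeff (coeff ((point \<nu> $ i - const_bipoly (\<mu> $ i)) ^ N) 0) 0 \<noteq> 0"
          using i by (simp add: constant_coeff_power constant_coeff_point
              constant_coeff_const_bipoly)
        show "jet M ((point \<nu> $ i - const_bipoly (\<mu> $ i)) ^ N) (at_weight \<nu> w) r = 0" for r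
          unfolding power(2)[OF w, symmetric] N by simp
      qed
    qed
    with w show "w \<in> {w \<in> lattice_space M. \<forall>\<nu> r. cweight \<nu> \<noteq> \<mu> \<longrightarrow> at_weight \<nu> w r = 0}"
      by simp
  }
  {
    assume "w \<in> {w \<in> lattice_space M. \<forall>\<nu> r. cweight \<nu> \<noteq> \<mu> \<longrightarrow> at_weight \<nu> w r = 0}"
    then have w: "w \<in> lattice_space M"
      and zero: "\<And>\<nu>. cweight \<nu> \<noteq> \<mu> \<Longrightarrow> at_weight \<nu> w = (\<lambda>r. 0)"
      by auto
    \<comment> \<open>The exponent 3 comes from the three levels and serves all \<open>i\<close> at
      once, as the definition of a weight space requires.\<close>
    have "(?T i ^^ 3) w = 0" for i
    proof (rule weight_eqI)
      fix \<nu> r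
      have "jet M ((point \<nu> $ i - const_bipoly (\<mu> $ i)) ^ 3) (at_weight \<nu> w) = (\<lambda>r. 0)"
      proof (cases "cweight \<nu> = \<mu>")
        case True
        then have "\<mu> $ i = of_int (\<nu> $ i)"
          by (auto simp: cweight_def)
        then show ?thesis
          by (intro jet_cube_zero M lattice_spaceD(1)[OF w])
             (simp add: constant_coeff_point constant_coeff_const_bipoly)
      next
        case False
        then show ?thesis
          using zero M by auto
      qed
      then show "at_weight \<nu> ((?T i ^^ 3) w) r = at_weight \<nu> 0 r"
        using power(2)[OF w] by simp
    qed
    then have "\<forall>i. (?T i ^^ 3) w = 0"
      by blast
    then have "\<exists>N>0. \<forall>i. (?T i ^^ N) w = 0"
      by (intro exI[of _ 3]) simp
    with w show "w \<in> weight_space (lattice_rep M) \<mu>"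
      unfolding weight_space_def by simp
  }
qed

lemma cweight_inject [simp]: "cweight \<mu> = cweight \<nu> \<longleftrightarrow> \<mu> = \<nu>"
  by (simp add: cweight_def vec_eq_iff)

lemma generalized_weight_module_lattice_rep:
  assumes M: "M \<in> free2_fd_modules"
  shows "generalized_weight_module (lattice_rep M)"
  unfolding generalized_weight_module_def
proof (intro conjI operator_module_lattice_rep M ballI)
  fix m
  assume "m \<in> rep_space (lattice_rep M)"
  then have m: "m \<in> lattice_space M"
    by simp
  note ws = weight_space_lattice_rep[OF M]
  define part where
    "part \<mu> = assemble (\<lambda>(\<nu>, r). if cweight \<nu> = \<mu> then at_weight \<nu> m r else 0)" for \<mu>
  have part: "at_weight \<nu> (part \<mu>) r = (if cweight \<nu> = \<mu> then at_weight \<nu> m r else 0)" for \<mu> \<nu> r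
    unfolding part_def
    by (rule at_weight_assemble) (rule finite_subset[OF _ finite_weights[of m]], auto)
  \<comment> \<open>In any decomposition into weight vectors the component at \<open>\<nu>\<close>
    can only come from the summand of weight \<open>cweight \<nu>\<close>; this gives both existence
    and uniqueness.\<close>
  have total: "at_weight \<nu> (\<Sum>\<mu> | v \<mu> \<noteq> 0. v \<mu>) r = at_weight \<nu> (v (cweight \<nu>)) r"
    if v: "\<And>\<mu>. v \<mu> \<in> weight_space (lattice_rep M) \<mu>" and fin: "finite {\<mu>. v \<mu> \<noteq> 0}" for v \<nu> r
  proof -
    have "at_weight \<nu> (\<Sum>\<mu> | v \<mu> \<noteq> 0. v \<mu>) r
        = (\<Sum>\<mu> | v \<mu> \<noteq> 0. if \<mu> = cweight \<nu> then at_weight \<nu> (v (cweight \<nu>)) r else 0)"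
      unfolding at_weight_simps using v by (intro sum.cong) (auto simp: ws)
    also have "\<dots> = at_weight \<nu> (v (cweight \<nu>)) r"
      using fin by (auto simp: sum.delta)
    finally show ?thesis .
  qed
  have part_in: "part \<mu> \<in> weight_space (lattice_rep M) \<mu>" for \<mu>
    using lattice_spaceD[OF m] subspace_closed(1)[OF free2_subspace[OF M]]
    by (auto simp: ws lattice_space_def part)
  have part_fin: "finite {\<mu>. part \<mu> \<noteq> 0}"
  proof (rule finite_subset)
    show "{\<mu>. part \<mu> \<noteq> 0} \<subseteq> cweight ` {\<nu>. \<exists>r. at_weight \<nu> m r \<noteq> 0}"
    proof
      fix \<mu>
      assume "\<mu> \<in> {\<mu>. part \<mu> \<noteq> 0}"
      then obtain \<nu> r where "at_weight \<nu> (part \<mu>) r \<noteq> 0"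
        using weight_eqI[of "part \<mu>" 0] by auto
      then show "\<mu> \<in> cweight ` {\<nu>. \<exists>r. at_weight \<nu> m r \<noteq> 0}"
        unfolding part by (auto split: if_splits)
    qed
  qed (use finite_weights in auto)
  show "\<exists>!v. (\<forall>\<mu>. v \<mu> \<in> weight_space (lattice_rep M) \<mu>)
      \<and> finite {\<mu>. v \<mu> \<noteq> 0} \<and> m = (\<Sum>\<mu> | v \<mu> \<noteq> 0. v \<mu>)"
  proof (rule ex1I[of _ part])
    have "m = (\<Sum>\<mu> | part \<mu> \<noteq> 0. part \<mu>)"
      by (rule weight_eqI) (simp only: total[OF part_in part_fin] part, simp)
    then show "(\<forall>\<mu>. part \<mu> \<in> weight_space (lattice_rep M) \<mu>)
      \<and> finite {\<mu>. part \<mu> \<noteq> 0} \<and> m = (\<Sum>\<mu> | part \<mu> \<noteq> 0. part \<mu>)"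
      using part_in part_fin by blast
  next
    fix v
    assume v: "(\<forall>\<mu>. v \<mu> \<in> weight_space (lattice_rep M) \<mu>)
      \<and> finite {\<mu>. v \<mu> \<noteq> 0} \<and> m = (\<Sum>\<mu> | v \<mu> \<noteq> 0. v \<mu>)"
    have "at_weight \<nu> (v \<mu>) r = at_weight \<nu> (part \<mu>) r" for \<mu> \<nu> r
    proof (cases "cweight \<nu> = \<mu>")
      case True
      then show ?thesis
        using total[of v \<nu> r] v part by auto
    next
      case False
      then show ?thesis
        using v part by (auto simp: ws)
    qed
    then have "v \<mu> = part \<mu>" for \<mu>
      by (rule weight_eqI)
    then show "v = part" ..
  qed
qed

lemma finite_dimensional_weight_space:
  assumes M: "M \<in> free2_fd_modules"
  shows "finite_dimensional (weight_space (lattice_rep M) \<mu>)"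
proof -
  obtain B where B: "finite B" "rep_space M \<subseteq> cvs.span B"
    using M by (auto simp: free2_fd_modules_def finite_dimensional_def)
  \<comment> \<open>For \<open>\<mu>\<close> outside the lattice the choice is arbitrary but
    harmless: all components of \<open>w\<close> are then zero.\<close>
  define \<nu> where "\<nu> = (SOME \<nu>. cweight \<nu> = \<mu>)"
  let ?e = "\<lambda>r x. place \<nu> (\<lambda>r'. if r' = r then x else 0)"
  let ?S = "(\<lambda>(r, x). ?e r x) ` (UNIV \<times> B)"
  have e: "?e r x \<in> cvs.span ?S" if "x \<in> cvs.span B" for r x
    using that
  proof (induction rule: cvs.span_induct)
    show "cvs.subspace {x. ?e r x \<in> cvs.span ?S}"
    proof -
      have "?e r 0 = 0" "?e r (x + y) = ?e r x + ?e r y" "?e r (cscale c x) = cscale c (?e r x)"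
        for x y c
        by (rule weight_eqI; simp add: at_weight_place)+
      then show ?thesis
        by (auto simp: cvs.subspace_def cvs.span_zero cvs.span_add cvs.span_scale)
    qed
    show "?e r x \<in> cvs.span ?S" if "x \<in> B" for x
      using that by (intro cvs.span_base rev_image_eqI[of "(r, x)"]) auto
  qed
  have "weight_space (lattice_rep M) \<mu> \<subseteq> cvs.span ?S"
  proof
    fix w
    assume "w \<in> weight_space (lattice_rep M) \<mu>"
    then have w: "w \<in> lattice_space M" and zero: "\<And>\<nu> r. cweight \<nu> \<noteq> \<mu> \<Longrightarrow> at_weight \<nu> w r = 0"
      by (auto simp: weight_space_lattice_rep[OF M])
    have "w = (\<Sum>r\<in>UNIV. ?e r (at_weight \<nu> w r))"
    proof (rule weight_eqI)
      fix \<kappa> r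
      show "at_weight \<kappa> w r = at_weight \<kappa> (\<Sum>r\<in>UNIV. ?e r (at_weight \<nu> w r)) r"
      proof (cases "\<kappa> = \<nu>")
        case True
        have "(\<Sum>s\<in>UNIV. if r = s then at_weight \<nu> w s else 0) = at_weight \<nu> w r"
          by (simp add: sum.delta')
        with True show ?thesis
          by (simp add: at_weight_place)
      next
        case False
        then have "cweight \<kappa> \<noteq> \<mu>"
          unfolding \<nu>_def by (metis (mono_tags) cweight_inject someI_ex)
        with False zero show ?thesis
          by (simp add: at_weight_place)
      qed
    qed
    moreover have "at_weight \<nu> w r \<in> cvs.span B" for r
      using lattice_spaceD(1)[OF w] B(2) by blast
    then have "(\<Sum>r\<in>UNIV. ?e r (at_weight \<nu> w r)) \<in> cvs.span ?S"
      by (intro cvs.span_sum e)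
    ultimately show "w \<in> cvs.span ?S"
      by (rule ssubst)
  qed
  moreover have "finite ?S"
    using B(1) by simp
  ultimately show ?thesis
    unfolding finite_dimensional_def by (intro exI[of _ ?S] conjI)
qed

text \<open>On the hyperplane of coordinate sum \<open>a\<close>, \<open>E - a\<close> acts as
  \<open>X + Y\<close>, whose cube is zero.\<close>

lemma lattice_rep_in_bDEH_0:
  assumes M: "M \<in> free2_fd_modules"
  shows "lattice_rep M \<in> bDEH_0 (of_int a)"
proof -
  have euler: "euler \<in> weyl_centralizer"
    by (simp add: weyl_centralizer_def euler_in_weyl)
  have nilpotent: "((\<lambda>x. act M euler x - cscale (of_int a) x) ^^ 3) m = 0"
    if m: "m \<in> lattice_space M" for m
  proof (rule weight_eqI)
    fix \<nu> r
    let ?q = "(\<Sum>i\<in>UNIV. point \<nu> $ i) - const_bipoly (of_int a)"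
    have "jet M (?q ^ 3) (at_weight \<nu> m) = (\<lambda>r. 0)"
    proof (cases "(\<Sum>i\<in>UNIV. \<nu> $ i) = a")
      case True
      have "(\<Sum>i\<in>UNIV. coeff (coeff (point \<nu> $ i) 0) 0) = of_int (\<Sum>i\<in>UNIV. \<nu> $ i)"
        by (simp add: constant_coeff_point)
      with True show ?thesis
        by (intro jet_cube_zero M lattice_spaceD(1)[OF m])
           (simp add: coeff_sum constant_coeff_const_bipoly)
    next
      case False
      then have "at_weight \<nu> m = (\<lambda>r. 0)"
        using lattice_spaceD(2)[OF m] by auto
      then show ?thesis
        using M by auto
    qed
    then show "at_weight \<nu> (((\<lambda>x. act M euler x - cscale (of_int a) x) ^^ 3) m) r
        = at_weight \<nu> 0 r"
      by (simp add: diagonal_power(2)[OF M euler symbol_euler m])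
  qed
  have "\<mu> $ i \<in> \<int>" if "\<mu> \<in> weight_support (lattice_rep M)" for \<mu> i
  proof (rule ccontr)
    assume "\<mu> $ i \<notin> \<int>"
    then have not_weight: "cweight \<nu> \<noteq> \<mu>" for \<nu>
      by (auto simp: cweight_def)
    have "w = 0" if w: "w \<in> weight_space (lattice_rep M) \<mu>" for w
      by (rule weight_eqI) (use w in \<open>simp add: not_weight weight_space_lattice_rep[OF M]\<close>)
    moreover have "0 \<in> weight_space (lattice_rep M) \<mu>"
      using subspace_closed(1)[OF subspace_lattice_space[OF M]]
      by (simp add: weight_space_lattice_rep[OF M])
    ultimately show False
      using that by (auto simp: weight_support_def)
  qed
  moreover have "\<forall>m\<in>lattice_space M. \<exists>N. ((\<lambda>x. act M euler x - cscale (of_int a) x) ^^ N) m = 0"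
    using nilpotent by (intro ballI exI)
  ultimately show ?thesis
    unfolding bDEH_0_def
    using generalized_weight_module_lattice_rep[OF M] finite_dimensional_weight_space[OF M]
    by auto
qed

end

section \<open>The functor on morphisms\<close>

lemma rep_homD:
  assumes "f \<in> rep_hom L M N"
  shows rep_hom_in: "x \<in> rep_space M \<Longrightarrow> f x \<in> rep_space N"
    and rep_hom_ext: "f \<in> extensional (rep_space M)"
    and rep_hom_add: "x \<in> rep_space M \<Longrightarrow> y \<in> rep_space M \<Longrightarrow> f (x + y) = f x + f y"
    and rep_hom_scale: "x \<in> rep_space M \<Longrightarrow> f (cscale c x) = cscale c (f x)"
    and rep_hom_act: "P \<in> L \<Longrightarrow> x \<in> rep_space M \<Longrightarrow> f (rep_act M P x) = rep_act N P (f x)"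
  using assms by (auto simp: rep_hom_def linear_between_def PiE_def)

lemma rep_homI:
  assumes "\<And>x. x \<in> rep_space M \<Longrightarrow> f x \<in> rep_space N"
    and "f \<in> extensional (rep_space M)"
    and "\<And>x y. x \<in> rep_space M \<Longrightarrow> y \<in> rep_space M \<Longrightarrow> f (x + y) = f x + f y"
    and "\<And>c x. x \<in> rep_space M \<Longrightarrow> f (cscale c x) = cscale c (f x)"
    and "\<And>P x. P \<in> L \<Longrightarrow> x \<in> rep_space M \<Longrightarrow> f (rep_act M P x) = rep_act N P (f x)"
  shows "f \<in> rep_hom L M N"
  using assms by (auto simp: rep_hom_def linear_between_def PiE_def)

context
  fixes L :: "'g set" and M N :: "'g rep" and f
  assumes f: "f \<in> rep_hom L M N" and sub: "cvs.subspace (rep_space M)"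
begin

lemma rep_hom_zero: "f 0 = 0"
  using rep_hom_scale[OF f, of 0 0] subspace_closed(1)[OF sub] by simp

lemma rep_hom_diff: "x \<in> rep_space M \<Longrightarrow> y \<in> rep_space M \<Longrightarrow> f (x - y) = f x - f y"
  using rep_hom_add[OF f, of "x - y" y] subspace_closed(4)[OF sub, of x y] by simp

lemma rep_hom_sum: "(\<And>s. s \<in> S \<Longrightarrow> g s \<in> rep_space M) \<Longrightarrow> f (sum g S) = (\<Sum>s\<in>S. f (g s))"
proof (induction S rule: infinite_finite_induct)
  case (insert s S)
  then have "f (g s + sum g S) = f (g s) + f (sum g S)"
    by (intro rep_hom_add[OF f] subspace_closed(5)[OF sub]) auto
  with insert show ?case
    by simp
qed (simp_all add: rep_hom_zero)

lemma rep_hom_inverse: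
  assumes bij: "bij_betw f (rep_space M) (rep_space N)"
    and closed: "\<And>P x. P \<in> L \<Longrightarrow> x \<in> rep_space M \<Longrightarrow> rep_act M P x \<in> rep_space M"
  shows "(\<lambda>y\<in>rep_space N. inv_into (rep_space M) f y) \<in> rep_hom L N M"
proof -
  let ?g = "inv_into (rep_space M) f"
  have gf: "x \<in> rep_space M \<Longrightarrow> ?g (f x) = x" for x
    using bij by (simp add: bij_betw_def)
  have ex: "\<exists>x\<in>rep_space M. y = f x" if "y \<in> rep_space N" for y
    using bij that by (auto simp: bij_betw_def)
  show ?thesis
  proof (rule rep_homI)
    fix y
    assume "y \<in> rep_space N"
    then obtain x where x: "x \<in> rep_space M" "y = f x"
      using ex by blast
    then show "(\<lambda>y\<in>rep_space N. ?g y) y \<in> rep_space M"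
      by (simp add: gf rep_hom_in[OF f])
    show "(\<lambda>y\<in>rep_space N. ?g y) (cscale c y) = cscale c ((\<lambda>y\<in>rep_space N. ?g y) y)" for c
      using x subspace_closed(3)[OF sub]
      by (simp add: gf rep_hom_in[OF f] rep_hom_scale[OF f, symmetric])
    show "(\<lambda>y\<in>rep_space N. ?g y) (rep_act N P y) = rep_act M P ((\<lambda>y\<in>rep_space N. ?g y) y)"
      if "P \<in> L" for P
      using x that closed
      by (simp add: gf rep_hom_in[OF f] rep_hom_act[OF f, symmetric])
    fix y'
    assume "y' \<in> rep_space N"
    then obtain x' where x': "x' \<in> rep_space M" "y' = f x'"
      using ex by blast
    show "(\<lambda>y\<in>rep_space N. ?g y) (y + y')
        = (\<lambda>y\<in>rep_space N. ?g y) y + (\<lambda>y\<in>rep_space N. ?g y) y'"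
      using x x' subspace_closed(2)[OF sub]
      by (simp add: gf rep_hom_in[OF f] rep_hom_add[OF f, symmetric])
  qed simp
qed

end

text \<open>\<open>jet\<close> is built from sums, scalars and the two generators, all of which a
  morphism respects.\<close>

lemma jet_hom:
  assumes f: "f \<in> rep_hom UNIV M N" and M: "M \<in> free2_fd_modules"
    and v: "\<And>r. v r \<in> rep_space M"
  shows "jet N q (\<lambda>r. f (v r)) r = f (jet M q v r)"
proof -
  note closed = subspace_closed(2,3)[OF free2_subspace[OF M]] free2_closed[OF M]
  have "jet N q (\<lambda>r. f (v r)) = (\<lambda>r. f (jet M q v r))"
    by (rule slots_eqI)
       (simp_all add: jet.simps v closed rep_hom_add[OF f] rep_hom_scale[OF f] rep_hom_act[OF f])
  then show ?thesis
    by (rule fun_cong)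
qed

context lattice_functor
begin

definition lattice_map :: "bool rep \<Rightarrow> (vec \<Rightarrow> vec) \<Rightarrow> vec \<Rightarrow> vec" where
  "lattice_map M f = (\<lambda>w\<in>lattice_space M. assemble (\<lambda>(\<mu>, r). f (at_weight \<mu> w r)))"

lemma at_weight_assemble_map:
  assumes "f 0 = 0"
  shows "at_weight \<mu> (assemble (\<lambda>(\<mu>, r). f (at_weight \<mu> w r))) r = f (at_weight \<mu> w r)"
proof (rule at_weight_assemble)
  show "finite {\<mu>. \<exists>r. f (at_weight \<mu> w r) \<noteq> 0}"
    by (rule finite_subset[OF _ finite_weights[of w]], rule subsetI) (use assms in \<open>simp, metis\<close>)
qed

lemma at_weight_lattice_map:
  assumes "M \<in> free2_fd_modules" "f \<in> rep_hom UNIV M N" "w \<in> lattice_space M"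
  shows "at_weight \<mu> (lattice_map M f w) r = f (at_weight \<mu> w r)"
  using assms at_weight_assemble_map[of f, OF rep_hom_zero[OF assms(2) free2_subspace]]
  by (simp add: lattice_map_def)

lemma lattice_map_hom:
  assumes M: "M \<in> free2_fd_modules" and N: "N \<in> free2_fd_modules" and f: "f \<in> rep_hom UNIV M N"
  shows "lattice_map M f \<in> rep_hom weyl_centralizer (lattice_rep M) (lattice_rep N)"
proof (rule rep_homI, unfold rep_sel)
  note map = at_weight_lattice_map[OF M f]
  note space = subspace_closed[OF subspace_lattice_space[OF M]]
  show "lattice_map M f w \<in> lattice_space N" if w: "w \<in> lattice_space M" for w
    using lattice_spaceD[OF w] rep_hom_in[OF f] rep_hom_zero[OF f free2_subspace[OF M]]
    by (simp add: lattice_space_def map w)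
  show "lattice_map M f \<in> extensional (lattice_space M)"
    by (simp add: lattice_map_def)
  fix v w
  assume v: "v \<in> lattice_space M"
  show "lattice_map M f (cscale c v) = cscale c (lattice_map M f v)" for c
    by (rule weight_eqI) (simp add: map space v rep_hom_scale[OF f] lattice_spaceD[OF v])
  show "lattice_map M f (act M P v) = act N P (lattice_map M f v)" if P: "P \<in> weyl_centralizer" for P
  proof (rule weight_eqI)
    fix \<nu> r
    have W: "P \<in> weyl"
      using P by (simp add: weyl_centralizer_def)
    note act = at_weight_act[OF _ W finite_support_symbol[OF W] order_refl]
    have "at_weight \<mu> (lattice_map M f v) = (\<lambda>r. f (at_weight \<mu> v r))" for \<mu>
      by (rule ext) (simp add: map v)
    then have "at_weight \<nu> (act N P (lattice_map M f v)) r = (\<Sum>k\<in>support (symbol i0 P).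
        f (jet M (symbol i0 P k (point (\<nu> - k))) (at_weight (\<nu> - k) v) r))"
      by (simp add: act[OF N] jet_hom[OF f M] lattice_spaceD(1)[OF v])
    also have "\<dots> = f (at_weight \<nu> (act M P v) r)"
      unfolding act[OF M]
      by (intro rep_hom_sum[OF f free2_subspace[OF M], symmetric] jet_closed[OF M]
          lattice_spaceD(1)[OF v])
    finally show "at_weight \<nu> (lattice_map M f (act M P v)) r
        = at_weight \<nu> (act N P (lattice_map M f v)) r"
      by (simp add: map act_closed[OF M P v])
  qed
  assume w: "w \<in> lattice_space M"
  show "lattice_map M f (v + w) = lattice_map M f v + lattice_map M f w"
    by (rule weight_eqI)
       (simp add: map space v w rep_hom_add[OF f] lattice_spaceD[OF v] lattice_spaceD[OF w])
qed

lemma lattice_map_ident: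
  assumes M: "M \<in> free2_fd_modules"
  shows "lattice_map M (\<lambda>x\<in>rep_space M. x) = (\<lambda>w\<in>lattice_space M. w)"
proof (rule extensionalityI[where A = "lattice_space M"])
  fix w
  assume w: "w \<in> lattice_space M"
  have zero: "(\<lambda>x\<in>rep_space M. x) 0 = 0"
    using subspace_closed(1)[OF free2_subspace[OF M]] by simp
  show "lattice_map M (\<lambda>x\<in>rep_space M. x) w = (\<lambda>w\<in>lattice_space M. w) w"
  proof (rule weight_eqI)
    fix \<mu> r
    have "at_weight \<mu> (lattice_map M (\<lambda>x\<in>rep_space M. x) w) r
        = (\<lambda>x\<in>rep_space M. x) (at_weight \<mu> w r)"
      unfolding lattice_map_def
      using w at_weight_assemble_map[of "\<lambda>x\<in>rep_space M. x", OF zero] by simp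
    then show "at_weight \<mu> (lattice_map M (\<lambda>x\<in>rep_space M. x) w) r
        = at_weight \<mu> ((\<lambda>w\<in>lattice_space M. w) w) r"
      by (simp add: w lattice_spaceD(1)[OF w])
  qed
qed (simp_all add: lattice_map_def)

lemma compose_hom:
  assumes "f \<in> rep_hom L X Y" "g \<in> rep_hom L Y Z" "cvs.subspace (rep_space X)"
    "\<And>P x. P \<in> L \<Longrightarrow> x \<in> rep_space X \<Longrightarrow> rep_act X P x \<in> rep_space X"
  shows "compose (rep_space X) g f \<in> rep_hom L X Z"
  using assms subspace_closed[OF assms(3)]
  by (intro rep_homI)
     (simp_all add: compose_def rep_hom_in[OF assms(1)] rep_hom_in[OF assms(2)]
       rep_hom_add[OF assms(1)] rep_hom_add[OF assms(2)] rep_hom_scale[OF assms(1)]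
       rep_hom_scale[OF assms(2)] rep_hom_act[OF assms(1)] rep_hom_act[OF assms(2)])

lemma lattice_map_compose:
  assumes X: "X \<in> free2_fd_modules" and Y: "Y \<in> free2_fd_modules"
    and f: "f \<in> rep_hom UNIV X Y" and g: "g \<in> rep_hom UNIV Y Z"
  shows "lattice_map X (compose (rep_space X) g f)
     = compose (lattice_space X) (lattice_map Y g) (lattice_map X f)"
proof (rule extensionalityI[where A = "lattice_space X"])
  fix w
  assume w: "w \<in> lattice_space X"
  have gf: "compose (rep_space X) g f \<in> rep_hom UNIV X Z"
    by (rule compose_hom[OF f g free2_subspace[OF X] free2_closed[OF X]])
  have fw: "lattice_map X f w \<in> lattice_space Y"
    using rep_hom_in[OF lattice_map_hom[OF X Y f]] w by simp
  show "lattice_map X (compose (rep_space X) g f) w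
      = compose (lattice_space X) (lattice_map Y g) (lattice_map X f) w"
    by (rule weight_eqI)
       (simp add: at_weight_lattice_map[OF X gf w] compose_eq w lattice_spaceD(1)[OF w]
         at_weight_lattice_map[OF Y g fw] at_weight_lattice_map[OF X f w])
qed (simp_all add: lattice_map_def)

lemma lattice_map_add:
  assumes X: "X \<in> free2_fd_modules" and Y: "Y \<in> free2_fd_modules"
    and f: "f \<in> rep_hom UNIV X Y" and g: "g \<in> rep_hom UNIV X Y"
  shows "lattice_map X (\<lambda>x\<in>rep_space X. f x + g x)
     = (\<lambda>w\<in>lattice_space X. lattice_map X f w + lattice_map X g w)"
proof (rule extensionalityI[where A = "lattice_space X"])
  fix w
  assume w: "w \<in> lattice_space X"
  let ?h = "\<lambda>x\<in>rep_space X. f x + g x"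
  have zero: "?h 0 = 0"
    using subspace_closed(1)[OF free2_subspace[OF X]] rep_hom_zero[OF f free2_subspace[OF X]]
      rep_hom_zero[OF g free2_subspace[OF X]] by simp
  show "lattice_map X (\<lambda>x\<in>rep_space X. f x + g x) w
      = (\<lambda>w\<in>lattice_space X. lattice_map X f w + lattice_map X g w) w"
  proof (rule weight_eqI)
    fix \<mu> r
    have "at_weight \<mu> (lattice_map X (\<lambda>x\<in>rep_space X. f x + g x) w) r
        = (\<lambda>x\<in>rep_space X. f x + g x) (at_weight \<mu> w r)"
      unfolding lattice_map_def using w at_weight_assemble_map[of "?h", OF zero] by simp
    then show "at_weight \<mu> (lattice_map X (\<lambda>x\<in>rep_space X. f x + g x) w) r
        = at_weight \<mu> ((\<lambda>w\<in>lattice_space X. lattice_map X f w + lattice_map X g w) w) r"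
      by (simp add: w lattice_spaceD(1)[OF w] at_weight_lattice_map[OF X f w]
          at_weight_lattice_map[OF X g w])
  qed
qed (simp_all add: lattice_map_def)

lemma lattice_map_scale:
  assumes X: "X \<in> free2_fd_modules" and f: "f \<in> rep_hom UNIV X Y"
  shows "lattice_map X (\<lambda>x\<in>rep_space X. cscale c (f x))
     = (\<lambda>w\<in>lattice_space X. cscale c (lattice_map X f w))"
proof (rule extensionalityI[where A = "lattice_space X"])
  fix w
  assume w: "w \<in> lattice_space X"
  let ?h = "\<lambda>x\<in>rep_space X. cscale c (f x)"
  have zero: "?h 0 = 0"
    using subspace_closed(1)[OF free2_subspace[OF X]] rep_hom_zero[OF f free2_subspace[OF X]]
    by simp
  show "lattice_map X (\<lambda>x\<in>rep_space X. cscale c (f x)) w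
      = (\<lambda>w\<in>lattice_space X. cscale c (lattice_map X f w)) w"
  proof (rule weight_eqI)
    fix \<mu> r
    have "at_weight \<mu> (lattice_map X (\<lambda>x\<in>rep_space X. cscale c (f x)) w) r
        = (\<lambda>x\<in>rep_space X. cscale c (f x)) (at_weight \<mu> w r)"
      unfolding lattice_map_def using w at_weight_assemble_map[of "?h", OF zero] by simp
    then show "at_weight \<mu> (lattice_map X (\<lambda>x\<in>rep_space X. cscale c (f x)) w) r
        = at_weight \<mu> ((\<lambda>w\<in>lattice_space X. cscale c (lattice_map X f w)) w) r"
      by (simp add: w lattice_spaceD(1)[OF w] at_weight_lattice_map[OF X f w])
  qed
qed (simp_all add: lattice_map_def)

lemma lattice_map_image:
  assumes X: "X \<in> free2_fd_modules" and f: "f \<in> rep_hom UNIV X Y"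
    and w: "w \<in> lattice_space Y" and image: "\<And>\<mu> r. at_weight \<mu> w r \<in> f ` rep_space X"
  shows "w \<in> lattice_map X f ` lattice_space X"
proof -
  \<comment> \<open>A preimage of 0 chosen by \<open>inv_into\<close> could be a nonzero kernel
    element, which would appear at infinitely many weights. Forcing \<open>h 0 = 0\<close> preserves
    finite support.\<close>
  define h where "h y = (if y = 0 then 0 else inv_into (rep_space X) f y)" for y
  have h_zero: "h 0 = 0"
    by (simp add: h_def)
  have h_weight: "at_weight \<mu> (assemble (\<lambda>(\<mu>, r). h (at_weight \<mu> w r))) r = h (at_weight \<mu> w r)"
    for \<mu> r
    by (rule at_weight_assemble_map[of h, OF h_zero])
  let ?v = "assemble (\<lambda>(\<mu>, r). h (at_weight \<mu> w r))"
  have h: "h y \<in> rep_space X" "f (h y) = y" if "y \<in> f ` rep_space X" for y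
    using that subspace_closed(1)[OF free2_subspace[OF X]] rep_hom_zero[OF f free2_subspace[OF X]]
    by (auto simp: h_def inv_into_into f_inv_into_f)
  have v: "?v \<in> lattice_space X"
    using lattice_spaceD(2)[OF w] h(1)[OF image] h_zero by (simp add: lattice_space_def h_weight)
  have "w = lattice_map X f ?v"
    by (rule weight_eqI) (simp add: at_weight_lattice_map[OF X f v] h_weight h(2)[OF image])
  with v show ?thesis
    by blast
qed

text \<open>On underlying spaces the functor is a direct sum of copies of the forgetful functor, so
  exactness can be tested componentwise.\<close>

lemma lattice_map_exact:
  assumes X: "X \<in> free2_fd_modules" and Y: "Y \<in> free2_fd_modules" and Z: "Z \<in> free2_fd_modules"
    and exact: "short_exact UNIV X Y Z f g"
  shows "short_exact weyl_centralizer (lattice_rep X) (lattice_rep Y) (lattice_rep Z)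
     (lattice_map X f) (lattice_map Y g)"
proof -
  have f: "f \<in> rep_hom UNIV X Y" and g: "g \<in> rep_hom UNIV Y Z"
    and inj: "inj_on f (rep_space X)"
    and kernel: "f ` rep_space X = {y \<in> rep_space Y. g y = 0}"
    and surj: "g ` rep_space Y = rep_space Z"
    using exact by (auto simp: short_exact_def)
  note f_hom = lattice_map_hom[OF X Y f] and g_hom = lattice_map_hom[OF Y Z g]
  have "inj_on (lattice_map X f) (lattice_space X)"
  proof (rule inj_onI)
    fix v w
    assume v: "v \<in> lattice_space X" and w: "w \<in> lattice_space X"
      and eq: "lattice_map X f v = lattice_map X f w"
    show "v = w"
    proof (rule weight_eqI)
      fix \<mu> r
      have "f (at_weight \<mu> v r) = f (at_weight \<mu> w r)"
        using at_weight_lattice_map[OF X f v, of \<mu> r] at_weight_lattice_map[OF X f w, of \<mu> r] eq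
        by simp
      then show "at_weight \<mu> v r = at_weight \<mu> w r"
        using inj lattice_spaceD(1)[OF v] lattice_spaceD(1)[OF w] by (auto dest: inj_onD)
    qed
  qed
  moreover have "lattice_map X f ` lattice_space X
      = {w \<in> lattice_space Y. lattice_map Y g w = 0}"
  proof (intro set_eqI iffI)
    fix w
    assume "w \<in> lattice_map X f ` lattice_space X"
    then obtain v where v: "v \<in> lattice_space X" and w: "w = lattice_map X f v"
      by blast
    have w_in: "w \<in> lattice_space Y"
      using rep_hom_in[OF f_hom] v w by simp
    have "g (f x) = 0" if "x \<in> rep_space X" for x
      using kernel that by blast
    then have "at_weight \<mu> (lattice_map Y g w) r = at_weight \<mu> 0 r" for \<mu> r
      using at_weight_lattice_map[OF Y g w_in] at_weight_lattice_map[OF X f v]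
        lattice_spaceD(1)[OF v]
      by (simp add: w)
    then have "lattice_map Y g w = 0"
      by (rule weight_eqI)
    with w_in show "w \<in> {w \<in> lattice_space Y. lattice_map Y g w = 0}"
      by simp
  next
    fix w
    assume "w \<in> {w \<in> lattice_space Y. lattice_map Y g w = 0}"
    then have w: "w \<in> lattice_space Y" and zero: "lattice_map Y g w = 0"
      by auto
    have "g (at_weight \<mu> w r) = 0" for \<mu> r
      using at_weight_lattice_map[OF Y g w, of \<mu> r] zero by simp
    then show "w \<in> lattice_map X f ` lattice_space X"
      using lattice_spaceD(1)[OF w] by (intro lattice_map_image[OF X f w]) (simp add: kernel)
  qed
  moreover have "lattice_map Y g ` lattice_space Y = lattice_space Z"
  proof (intro subset_antisym subsetI)
    show "w \<in> lattice_space Z" if "w \<in> lattice_map Y g ` lattice_space Y" for w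
      using rep_hom_in[OF g_hom] that by auto
    show "w \<in> lattice_map Y g ` lattice_space Y" if w: "w \<in> lattice_space Z" for w
      using lattice_spaceD(1)[OF w] by (intro lattice_map_image[OF Y g w]) (simp add: surj)
  qed
  ultimately show ?thesis
    using f_hom g_hom by (simp add: short_exact_def)
qed

section \<open>Recovering a module over the free algebra\<close>

text \<open>The weight at which \<open>U\<close> is recovered, and the end point of the descent in
  \<open>weight_induct\<close>, since all coordinates other than \<open>i0\<close> vanish.\<close>

definition base :: "int ^ 'i" where
  "base = axis i0 a"

definition top_slots :: "vec \<Rightarrow> slots" where
  "top_slots x = (\<lambda>r. if r = Top then x else 0)"

definition bottom_slots :: "vec \<Rightarrow> slots" where
  "bottom_slots x = (\<lambda>r. if r = Bot then x else 0)"

definition tail :: "vec \<Rightarrow> vec" where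
  "tail x = place base (bottom_slots x)"

text \<open>At the weight \<open>base\<close> this strips the semisimple part, leaving
  \<open>X\<close> for \<open>i0\<close> and \<open>Y\<close> for \<open>i1\<close>. Morphisms
  commute with it, so they see the layers.\<close>

definition shifted_theta :: "bool rep \<Rightarrow> 'i \<Rightarrow> vec \<Rightarrow> vec" where
  "shifted_theta M i w = act M (theta i) w - cscale (of_int (base $ i)) w"

text \<open>Intended for \<open>i0\<close> and \<open>i1\<close> only; any further index receives
  \<open>Y\<close> as a default.\<close>

definition nilvar :: "'i \<Rightarrow> bipoly" where
  "nilvar i = (if i = i0 then [:0, 1:] else [:[:0, 1:]:])"

lemma sum_base: "(\<Sum>i\<in>UNIV. base $ i) = a"
  by (simp add: base_def axis_def)

lemma place_linear:
  "place \<mu> (\<lambda>r. v r + w r) = place \<mu> v + place \<mu> w"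
  "place \<mu> (\<lambda>r. cscale c (v r)) = cscale c (place \<mu> v)"
  "place \<mu> (\<lambda>r. 0) = 0"
  by (rule weight_eqI; simp add: at_weight_place)+

lemma place_inject: "place \<mu> v = place \<mu> w \<Longrightarrow> v = w"
  by (metis at_weight_place_same)

lemma tail_linear:
  "tail (x + y) = tail x + tail y" "tail (x - y) = tail x - tail y"
  "tail (cscale c x) = cscale c (tail x)" "tail 0 = 0"
  by (rule weight_eqI; simp add: tail_def at_weight_place bottom_slots_def)+

lemma tail_inject: "tail x = tail y \<longleftrightarrow> x = y"
proof
  assume "tail x = tail y"
  then have "bottom_slots x Bot = bottom_slots y Bot"
    unfolding tail_def by (metis place_inject)
  then show "x = y"
    by (simp add: bottom_slots_def)
qed simp

context
  fixes M :: "bool rep"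
  assumes M: "M \<in> free2_fd_modules"
begin

lemma zero_in: "0 \<in> rep_space M"
  by (rule subspace_closed(1)[OF free2_subspace[OF M]])

lemma place_base_in: "(\<And>r. v r \<in> rep_space M) \<Longrightarrow> place base v \<in> lattice_space M"
  by (rule place_in_lattice_space[OF M sum_base])

lemma tail_in: "x \<in> rep_space M \<Longrightarrow> tail x \<in> lattice_space M"
  unfolding tail_def by (rule place_base_in) (simp add: bottom_slots_def zero_in)

lemma top_slots_in: "x \<in> rep_space M \<Longrightarrow> top_slots x r \<in> rep_space M"
  by (simp add: top_slots_def zero_in)

lemma jet_nilvar:
  "jet M (nilvar i0) v Top = 0" "jet M (nilvar i0) v MidX = v Top"
  "jet M (nilvar i0) v MidY = 0" "jet M (nilvar i0) v Bot = v MidX + rep_act M False (v MidY)"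
  "jet M (nilvar i1) v Top = 0" "jet M (nilvar i1) v MidX = 0"
  "jet M (nilvar i1) v MidY = v Top"
  "jet M (nilvar i1) v Bot = rep_act M False (v MidX) + rep_act M True (v MidY)"
  using distinct by (simp_all add: jet.simps nilvar_def coeff_pCons split: nat.split)

lemma shifted_theta_place:
  assumes i: "i = i0 \<or> i = i1"
  shows "shifted_theta M i (place base v) = place base (jet M (nilvar i) v)"
proof (rule weight_eqI)
  fix \<nu> r
  note act = at_weight_act_mono_symbol[OF M theta_in_weyl symbol_theta]
  show "at_weight \<nu> (shifted_theta M i (place base v)) r
      = at_weight \<nu> (place base (jet M (nilvar i) v)) r"
  proof (cases "\<nu> = base")
    case True
    have "point base $ i = nilvar i + const_bipoly (of_int (base $ i))"
      using i by (auto simp: point_def nilvar_def const_bipoly_of_int)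
    then show ?thesis
      by (simp add: True shifted_theta_def act jet_add_poly)
  next
    case False
    then have "at_weight \<nu> (place base v) = (\<lambda>r. 0)"
      by (auto simp: at_weight_place)
    with False show ?thesis
      by (simp add: shifted_theta_def act M at_weight_place)
  qed
qed

lemma tail_from_top:
  "tail x = shifted_theta M i0 (shifted_theta M i0 (place base (top_slots x)))"
  "tail (rep_act M False x) = shifted_theta M i0 (shifted_theta M i1 (place base (top_slots x)))"
  "tail (rep_act M True x) = shifted_theta M i1 (shifted_theta M i1 (place base (top_slots x)))"
proof -
  have "jet M (nilvar i0) (jet M (nilvar i0) (top_slots x)) = bottom_slots x"
    "jet M (nilvar i0) (jet M (nilvar i1) (top_slots x)) = bottom_slots (rep_act M False x)"
    "jet M (nilvar i1) (jet M (nilvar i1) (top_slots x)) = bottom_slots (rep_act M True x)"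
    by (rule slots_eqI;
        simp add: jet_nilvar top_slots_def bottom_slots_def free2_zero[OF M])+
  then show "tail x = shifted_theta M i0 (shifted_theta M i0 (place base (top_slots x)))"
    "tail (rep_act M False x) = shifted_theta M i0 (shifted_theta M i1 (place base (top_slots x)))"
    "tail (rep_act M True x) = shifted_theta M i1 (shifted_theta M i1 (place base (top_slots x)))"
    by (simp_all add: shifted_theta_place tail_def)
qed

text \<open>Quadratic monomials see only the top component. Hence they can be applied to the image
  of a top vector under a morphism, whatever middle and bottom parts that image has.\<close>

lemma twice_shifted_theta:
  "shifted_theta M i0 (shifted_theta M i0 (place base v)) = tail (v Top)"
  "shifted_theta M i0 (shifted_theta M i1 (place base v)) = tail (rep_act M False (v Top))"
  "shifted_theta M i1 (shifted_theta M i1 (place base v)) = tail (rep_act M True (v Top))"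
proof -
  have "jet M (nilvar i0) (jet M (nilvar i0) v) = bottom_slots (v Top)"
    "jet M (nilvar i0) (jet M (nilvar i1) v) = bottom_slots (rep_act M False (v Top))"
    "jet M (nilvar i1) (jet M (nilvar i1) v) = bottom_slots (rep_act M True (v Top))"
    by (rule slots_eqI; simp add: jet_nilvar bottom_slots_def free2_zero[OF M])+
  then show "shifted_theta M i0 (shifted_theta M i0 (place base v)) = tail (v Top)"
    "shifted_theta M i0 (shifted_theta M i1 (place base v)) = tail (rep_act M False (v Top))"
    "shifted_theta M i1 (shifted_theta M i1 (place base v)) = tail (rep_act M True (v Top))"
    by (simp_all add: shifted_theta_place tail_def)
qed

lemma shifted_theta_in: "w \<in> lattice_space M \<Longrightarrow> shifted_theta M i w \<in> lattice_space M"
  unfolding shifted_theta_def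
  by (intro subspace_closed(3,4)[OF subspace_lattice_space[OF M]]
      act_closed[OF M theta_in_centralizer])

end

section \<open>Morphisms between constructed modules and the maps they induce on bottom
  layers\<close>

context
  fixes M N :: "bool rep" and \<phi>
  assumes M: "M \<in> free2_fd_modules" and N: "N \<in> free2_fd_modules"
    and \<phi>: "\<phi> \<in> rep_hom weyl_centralizer (lattice_rep M) (lattice_rep N)"
begin

lemma hom_in: "w \<in> lattice_space M \<Longrightarrow> \<phi> w \<in> lattice_space N"
  using rep_hom_in[OF \<phi>] by simp

lemma hom_shifted_theta:
  assumes w: "w \<in> lattice_space M"
  shows "\<phi> (act M (theta i) w - cscale c w) = act N (theta i) (\<phi> w) - cscale c (\<phi> w)"
proof -
  have "cscale c w \<in> lattice_space M" "act M (theta i) w \<in> lattice_space M"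
    using w by (simp_all add: subspace_closed(3)[OF subspace_lattice_space[OF M]]
        act_closed[OF M theta_in_centralizer])
  then show ?thesis
    using rep_hom_diff[OF \<phi>] rep_hom_scale[OF \<phi>, of w c]
      rep_hom_act[OF \<phi> theta_in_centralizer, of w] w
    by (simp add: subspace_lattice_space[OF M])
qed

lemma hom_weight_space:
  assumes "w \<in> weight_space (lattice_rep M) \<mu>"
  shows "\<phi> w \<in> weight_space (lattice_rep N) \<mu>"
proof -
  let ?T = "\<lambda>M i x. act M (theta i) x - cscale (\<mu> $ i) x"
  obtain n where n: "n > 0" "\<And>i. (?T M i ^^ n) w = 0" and w: "w \<in> lattice_space M"
    using assms by (auto simp: weight_space_def)
  have "\<phi> ((?T M i ^^ k) w) = (?T N i ^^ k) (\<phi> w)" for i k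
    using diagonal_power(1)[OF M theta_in_centralizer symbol_theta w]
    by (induction k) (simp_all add: hom_shifted_theta)
  moreover have "\<phi> 0 = 0"
    using rep_hom_zero[OF \<phi>] subspace_lattice_space[OF M] by simp
  ultimately have "(?T N i ^^ n) (\<phi> w) = 0" for i
    using n(2) by metis
  with n(1) hom_in[OF w] show ?thesis
    unfolding weight_space_def by auto
qed

lemma hom_place:
  assumes \<mu>: "(\<Sum>i\<in>UNIV. \<mu> $ i) = a" and v: "\<And>r. v r \<in> rep_space M"
  obtains v' where "\<phi> (place \<mu> v) = place \<mu> v'" "\<And>r. v' r \<in> rep_space N"
proof
  let ?w = "\<phi> (place \<mu> v)"
  have "place \<mu> v \<in> weight_space (lattice_rep M) (cweight \<mu>)"
    using place_in_lattice_space[OF M \<mu> v]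
    by (simp add: weight_space_lattice_rep[OF M] at_weight_place)
  from hom_weight_space[OF this]
  have w: "?w \<in> lattice_space N" "\<And>\<nu> r. \<nu> \<noteq> \<mu> \<Longrightarrow> at_weight \<nu> ?w r = 0"
    by (auto simp: weight_space_lattice_rep[OF N])
  show "?w = place \<mu> (at_weight \<mu> ?w)"
    by (rule weight_eqI) (simp add: at_weight_place w(2))
  show "at_weight \<mu> ?w r \<in> rep_space N" for r
    by (rule lattice_spaceD(1)[OF w(1)])
qed

text \<open>Only one coordinate is read off; \<open>hom_tail\<close> shows that nothing is lost,
  since tails go to tails.\<close>

definition corner :: "vec \<Rightarrow> vec" where
  "corner x = at_weight base (\<phi> (tail x)) Bot"

text \<open>Lift \<open>x\<close> to the top layer and let \<open>v\<close> be the components of its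
  image. Applying \<open>X^2\<close>, \<open>X Y\<close> and \<open>Y^2\<close> before or after the
  morphism gives three identities with the same \<open>y = v Top\<close>, so the induced map
  intertwines both generators.\<close>

lemma hom_tail_aux:
  assumes x: "x \<in> rep_space M"
  obtains y where "y \<in> rep_space N" "\<phi> (tail x) = tail y"
    "\<phi> (tail (rep_act M b x)) = tail (rep_act N b y)"
proof -
  obtain v where v: "\<phi> (place base (top_slots x)) = place base v" "\<And>r. v r \<in> rep_space N"
    using hom_place[OF sum_base, of "top_slots x"] top_slots_in[OF M x] by blast
  have top: "place base (top_slots x) \<in> lattice_space M"
    by (rule place_base_in[OF M top_slots_in[OF M x]])
  have "\<phi> (shifted_theta M i w) = shifted_theta N i (\<phi> w)" if "w \<in> lattice_space M" for i w
    using hom_shifted_theta[OF that] by (simp add: shifted_theta_def)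
  then have twice: "\<phi> (shifted_theta M i (shifted_theta M j (place base (top_slots x))))
      = shifted_theta N i (shifted_theta N j (place base v))" for i j
    using v(1) top shifted_theta_in[OF M] by simp
  have "\<phi> (tail x) = tail (v Top)"
    by (simp only: tail_from_top(1)[OF M, of x] twice twice_shifted_theta(1)[OF N])
  moreover have "\<phi> (tail (rep_act M False x)) = tail (rep_act N False (v Top))"
    by (simp only: tail_from_top(2)[OF M, of x] twice twice_shifted_theta(2)[OF N])
  moreover have "\<phi> (tail (rep_act M True x)) = tail (rep_act N True (v Top))"
    by (simp only: tail_from_top(3)[OF M, of x] twice twice_shifted_theta(3)[OF N])
  ultimately show thesis
    using that[of "v Top"] v(2) by (cases b) auto
qed

lemma corner_tail: "corner x = y" if "\<phi> (tail x) = tail y"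
  by (simp add: corner_def that tail_def[of y] bottom_slots_def)

lemma hom_tail:
  assumes "x \<in> rep_space M"
  shows "\<phi> (tail x) = tail (corner x)" "corner x \<in> rep_space N"
    "corner (rep_act M b x) = rep_act N b (corner x)"
proof -
  obtain y where y: "y \<in> rep_space N" "\<phi> (tail x) = tail y"
    "\<phi> (tail (rep_act M b x)) = tail (rep_act N b y)"
    using hom_tail_aux[OF assms] .
  then show "\<phi> (tail x) = tail (corner x)" "corner x \<in> rep_space N"
    "corner (rep_act M b x) = rep_act N b (corner x)"
    by (simp_all add: corner_tail)
qed

lemma corner_hom: "(\<lambda>x\<in>rep_space M. corner x) \<in> rep_hom UNIV M N"
proof (rule rep_homI)
  note sub = free2_subspace[OF M]
  fix x y
  assume x: "x \<in> rep_space M"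
  show "(\<lambda>x\<in>rep_space M. corner x) x \<in> rep_space N"
    using x hom_tail(2) by simp
  have "\<phi> (tail (cscale c x)) = tail (cscale c (corner x))" for c
    using rep_hom_scale[OF \<phi>, of "tail x" c] tail_in[OF M x] hom_tail(1)[OF x]
    by (simp add: tail_linear)
  then show "(\<lambda>x\<in>rep_space M. corner x) (cscale c x)
      = cscale c ((\<lambda>x\<in>rep_space M. corner x) x)" for c
    using x subspace_closed(3)[OF sub] by (simp add: corner_tail)
  show "(\<lambda>x\<in>rep_space M. corner x) (rep_act M b x)
      = rep_act N b ((\<lambda>x\<in>rep_space M. corner x) x)" for b
    using x hom_tail(3) free2_closed[OF M] by simp
  assume y: "y \<in> rep_space M"
  have "\<phi> (tail (x + y)) = tail (corner x + corner y)"
    using rep_hom_add[OF \<phi>, of "tail x" "tail y"] tail_in[OF M] x y hom_tail(1)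
    by (simp add: tail_linear)
  then show "(\<lambda>x\<in>rep_space M. corner x) (x + y)
      = (\<lambda>x\<in>rep_space M. corner x) x + (\<lambda>x\<in>rep_space M. corner x) y"
    using x y subspace_closed(2)[OF sub] by (simp add: corner_tail)
qed simp

end

text \<open>The corners of a morphism and of its inverse are mutually inverse, because
  \<open>tail\<close> is injective.\<close>

lemma lattice_rep_reflects_iso:
  assumes M: "M \<in> free2_fd_modules" and N: "N \<in> free2_fd_modules"
    and iso: "rep_isomorphic weyl_centralizer (lattice_rep M) (lattice_rep N)"
  shows "rep_isomorphic UNIV M N"
proof -
  obtain \<phi> where \<phi>: "\<phi> \<in> rep_hom weyl_centralizer (lattice_rep M) (lattice_rep N)"
    and bij: "bij_betw \<phi> (rep_space (lattice_rep M)) (rep_space (lattice_rep N))"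
    using iso by (auto simp: rep_isomorphic_def)
  define \<psi> where "\<psi> = (\<lambda>y\<in>lattice_space N. inv_into (lattice_space M) \<phi> y)"
  have \<psi>: "\<psi> \<in> rep_hom weyl_centralizer (lattice_rep N) (lattice_rep M)"
    unfolding \<psi>_def
    using rep_hom_inverse[OF \<phi> _ bij] subspace_lattice_space[OF M] act_closed[OF M] by simp
  note \<phi>_tail = hom_tail[OF M N \<phi>] and \<psi>_tail = hom_tail[OF N M \<psi>]
  have \<psi>\<phi>: "\<psi> (\<phi> w) = w" if "w \<in> lattice_space M" for w
    using bij that by (auto simp: \<psi>_def bij_betw_def)
  have \<phi>\<psi>: "\<phi> (\<psi> w) = w" if "w \<in> lattice_space N" for w
    using bij that by (auto simp: \<psi>_def bij_betw_def f_inv_into_f)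
  have "corner \<psi> (corner \<phi> x) = x" if x: "x \<in> rep_space M" for x
    using \<psi>\<phi>[OF tail_in[OF M x]] \<phi>_tail(1,2)[OF x] \<psi>_tail(1)
    by (simp add: tail_inject)
  moreover have "corner \<phi> (corner \<psi> y) = y" if y: "y \<in> rep_space N" for y
    using \<phi>\<psi>[OF tail_in[OF N y]] \<psi>_tail(1,2)[OF y] \<phi>_tail(1)
    by (simp add: tail_inject)
  ultimately have "bij_betw (\<lambda>x\<in>rep_space M. corner \<phi> x) (rep_space M) (rep_space N)"
    using \<phi>_tail(2) \<psi>_tail(2)
    by (intro bij_betwI[where g = "corner \<psi>"]) auto
  then show ?thesis
    using corner_hom[OF M N \<phi>] unfolding rep_isomorphic_def by blast
qed

section \<open>Indecomposability\<close>

lemma act_mult_deriv: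
  assumes M: "M \<in> free2_fd_modules" and j: "j \<noteq> i0"
  shows "at_weight \<nu> (act M (mult_t i0 \<circ> deriv_t j) w) r
     = at_weight (\<nu> - (axis i0 1 - axis j 1)) w r"
  by (simp add: at_weight_act_mono_symbol[OF M mult_deriv_in_weyl symbol_mult_deriv[OF j]])

text \<open>All weights are joined by operators \<open>t\<^sub>i\<^sub>0 \<partial>\<^sub>j\<close>, which act bijectively, so an endomorphism that
  vanishes at one weight vanishes everywhere.\<close>

lemma weight_induct:
  fixes D :: "int ^ 'i \<Rightarrow> bool"
  assumes base: "D base"
    and step: "\<And>\<mu> j. j \<noteq> i0 \<Longrightarrow> (\<Sum>i\<in>UNIV. \<mu> $ i) = a \<Longrightarrow>
      D \<mu> \<longleftrightarrow> D (\<mu> + (axis i0 1 - axis j 1))"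
    and \<mu>: "(\<Sum>i\<in>UNIV. \<mu> $ i) = a"
  shows "D \<mu>"
  using \<mu>
\<comment> \<open>Moving along \<open>axis i0 1 - axis j 1\<close>, forwards or backwards, brings
  coordinate \<open>j\<close> closer to 0. Coordinate \<open>i0\<close> absorbs the change and is
  left out of the measure.\<close>
proof (induction "\<Sum>i\<in>UNIV - {i0}. nat \<bar>\<mu> $ i\<bar>" arbitrary: \<mu> rule: less_induct)
  case less
  show ?case
  proof (cases "\<forall>j\<in>UNIV - {i0}. \<mu> $ j = 0")
    case True
    have "(\<Sum>i\<in>UNIV. \<mu> $ i) = \<mu> $ i0 + (\<Sum>i\<in>UNIV - {i0}. \<mu> $ i)"
      by (rule sum.remove) auto
    then have "\<mu> $ i0 = a"
      using less.prems True by simp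
    then have "\<mu> = base"
      using True by (auto simp: vec_eq_iff base_def axis_def)
    with base show ?thesis
      by simp
  next
    case False
    then obtain j where j: "j \<noteq> i0" "\<mu> $ j \<noteq> 0"
      by auto
    let ?l = "axis i0 1 - axis j 1 :: int ^ 'i"
    have sum_l: "(\<Sum>i\<in>UNIV. ?l $ i) = 0"
      by (simp add: sum_subtractf axis_def)
    have smaller: "D \<mu>'" if other: "\<And>i. i \<noteq> i0 \<Longrightarrow> i \<noteq> j \<Longrightarrow> \<mu>' $ i = \<mu> $ i"
      and at_j: "\<bar>\<mu>' $ j\<bar> < \<bar>\<mu> $ j\<bar>" and sum: "(\<Sum>i\<in>UNIV. \<mu>' $ i) = a" for \<mu>'
    proof (rule less.hyps[OF _ sum])
      show "(\<Sum>i\<in>UNIV - {i0}. nat \<bar>\<mu>' $ i\<bar>) < (\<Sum>i\<in>UNIV - {i0}. nat \<bar>\<mu> $ i\<bar>)"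
      proof (rule sum_strict_mono_ex1)
        show "\<forall>i\<in>UNIV - {i0}. nat \<bar>\<mu>' $ i\<bar> \<le> nat \<bar>\<mu> $ i\<bar>"
        proof
          fix i
          assume "i \<in> UNIV - {i0}"
          then show "nat \<bar>\<mu>' $ i\<bar> \<le> nat \<bar>\<mu> $ i\<bar>"
            using other[of i] at_j by (cases "i = j") auto
        qed
        show "\<exists>i\<in>UNIV - {i0}. nat \<bar>\<mu>' $ i\<bar> < nat \<bar>\<mu> $ i\<bar>"
          using j at_j by (intro bexI[of _ j]) auto
      qed simp
    qed
    show ?thesis
    proof (cases "\<mu> $ j > 0")
      case True
      have "D (\<mu> + ?l)"
        using j True less.prems sum_l
        by (intro smaller) (simp_all add: axis_def sum.distrib)
      then show ?thesis
        using step[OF j(1) less.prems] by simp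
    next
      case False
      have sum: "(\<Sum>i\<in>UNIV. (\<mu> - ?l) $ i) = a"
        using less.prems sum_l by (simp add: sum_subtractf)
      have "D (\<mu> - ?l)"
        using j False sum by (intro smaller) (simp_all add: axis_def)
      then show ?thesis
        using step[OF j(1) sum] by simp
    qed
  qed
qed

section \<open>Endomorphisms that vanish on the bottom layer\<close>

context
  fixes M :: "bool rep" and e
  assumes M: "M \<in> free2_fd_modules"
    and e: "e \<in> rep_hom weyl_centralizer (lattice_rep M) (lattice_rep M)"
    and e_tail: "\<And>x. x \<in> rep_space M \<Longrightarrow> e (tail x) = 0"
begin

lemma subspace_rep: "cvs.subspace (rep_space (lattice_rep M))"
  by (simp add: subspace_lattice_space[OF M])

text \<open>\<open>X^2\<close> carries the top component of the image to the bottom layer, where it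
  is the image of a tail and therefore zero.\<close>

lemma hom_kills_top:
  assumes v: "\<And>r. v r \<in> rep_space M" and v': "e (place base v) = place base v'"
  shows "v' Top = 0"
proof -
  have e_shift: "e (shifted_theta M i w) = shifted_theta M i (e w)" if "w \<in> lattice_space M" for i w
    using hom_shifted_theta[OF M M e that] by (simp add: shifted_theta_def)
  have "tail (v' Top) = e (tail (v Top))"
    using place_base_in[OF M v]
    by (simp add: twice_shifted_theta[OF M, symmetric] e_shift shifted_theta_in[OF M] v')
  also have "\<dots> = tail 0"
    using e_tail v by (simp add: tail_linear)
  finally show ?thesis
    by (simp only: tail_inject)
qed

text \<open>An element without top component is \<open>X p + Y s\<close> with \<open>p\<close> and \<open>s\<close> in the top layer, up to
  the bottom layer.\<close>

lemma hom_twice: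
  assumes v: "\<And>r. v r \<in> rep_space M" and top: "v Top = 0"
  shows "e (e (place base v)) = 0"
proof -
  have e_shift: "e (shifted_theta M i w) = shifted_theta M i (e w)" if "w \<in> lattice_space M" for i w
    using hom_shifted_theta[OF M M e that] by (simp add: shifted_theta_def)
  let ?t = "\<lambda>x. place base (top_slots x)"
  have t: "?t (v r) \<in> lattice_space M" for r
    by (intro place_base_in[OF M] top_slots_in[OF M] v)
  have v_eq: "place base v
      = shifted_theta M i0 (?t (v MidX)) + shifted_theta M i1 (?t (v MidY)) + tail (v Bot)"
  proof -
    have "v = (\<lambda>r. (jet M (nilvar i0) (top_slots (v MidX)) r
        + jet M (nilvar i1) (top_slots (v MidY)) r) + bottom_slots (v Bot) r)"
      by (rule slots_eqI)
         (simp_all add: jet_nilvar[OF M] top top_slots_def bottom_slots_def free2_zero[OF M])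
    then have "place base v = place base (\<lambda>r. (jet M (nilvar i0) (top_slots (v MidX)) r
        + jet M (nilvar i1) (top_slots (v MidY)) r) + bottom_slots (v Bot) r)"
      by (rule arg_cong)
    then show ?thesis
      by (simp only: place_linear tail_def shifted_theta_place[OF M] simp_thms)
  qed
  \<comment> \<open>The image of a top vector has no top component, so one further application of
    \<open>X\<close> or \<open>Y\<close> lands in the bottom layer.\<close>
  have image: "\<exists>x\<in>rep_space M. shifted_theta M i (e (?t (v r))) = tail x"
    if i: "i = i0 \<or> i = i1" for i r
  proof -
    obtain u where u: "e (?t (v r)) = place base u" "\<And>r. u r \<in> rep_space M"
      using hom_place[OF M M e sum_base, of "top_slots (v r)"] top_slots_in[OF M v] by blast
    have "u Top = 0"
      by (rule hom_kills_top[OF top_slots_in[OF M v] u(1)])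
    then have "jet M (nilvar i) u = bottom_slots (jet M (nilvar i) u Bot)"
      using i by (intro slots_eqI) (auto simp: jet_nilvar[OF M] bottom_slots_def)
    then have "shifted_theta M i (e (?t (v r))) = tail (jet M (nilvar i) u Bot)"
      unfolding u(1) shifted_theta_place[OF M i] tail_def by (rule arg_cong)
    then show ?thesis
      using jet_closed[of M u "nilvar i" Bot, OF M u(2)] by blast
  qed
  obtain x y where x: "x \<in> rep_space M" "shifted_theta M i0 (e (?t (v MidX))) = tail x"
    and y: "y \<in> rep_space M" "shifted_theta M i1 (e (?t (v MidY))) = tail y"
    using image by blast
  \<comment> \<open>One application of \<open>e\<close> thus reaches the bottom layer, and the
    second one kills it.\<close>
  have "e (place base v) = tail x + tail y"
    unfolding v_eq
    using x(2) y(2) e_tail[OF v] rep_hom_add[OF e]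
      subspace_closed(2)[OF subspace_lattice_space[OF M]]
    by (simp add: shifted_theta_in[OF M] t tail_in[OF M v] e_shift)
  then show ?thesis
    using rep_hom_add[OF e, of "tail x" "tail y"] tail_in[OF M] x(1) y(1) e_tail by simp
qed

text \<open>At \<open>base\<close> the cube of \<open>e\<close> is zero: the first application
  removes the top component, the next two kill the rest. An idempotent with zero cube is zero, and
  the invertible shifts spread this to every weight.\<close>

lemma idempotent_hom_zero:
  assumes idem: "\<And>w. w \<in> lattice_space M \<Longrightarrow> e (e w) = e w" and w: "w \<in> lattice_space M"
  shows "e w = 0"
proof -
  let ?D = "\<lambda>\<mu>. \<forall>v. (\<forall>r. v r \<in> rep_space M) \<longrightarrow> e (place \<mu> v) = 0"
  have D_base: "?D base"
  proof (intro allI impI)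
    fix v :: slots
    assume "\<forall>r. v r \<in> rep_space M"
    then have v: "\<And>r. v r \<in> rep_space M"
      by blast
    obtain v' where v': "e (place base v) = place base v'" "\<And>r. v' r \<in> rep_space M"
      using hom_place[OF M M e sum_base, of v] v by blast
    have "v' Top = 0"
      by (rule hom_kills_top[of v, OF v v'(1)])
    then have "e (e (place base v')) = 0"
      by (rule hom_twice[of v', OF v'(2)])
    then show "e (place base v) = 0"
      using idem[OF place_base_in[OF M v]] by (simp flip: v'(1))
  qed
  \<comment> \<open>\<open>e\<close> commutes with the shift by \<open>?l\<close>, which has no
    kernel, so vanishing passes between the two weights in both directions.\<close>
  have D_step: "?D \<mu> \<longleftrightarrow> ?D (\<mu> + (axis i0 1 - axis j 1))"
    if j: "j \<noteq> i0" and \<mu>: "(\<Sum>i\<in>UNIV. \<mu> $ i) = a" for \<mu> j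
  proof -
    let ?l = "axis i0 1 - axis j 1 :: int ^ 'i" and ?P = "mult_t i0 \<circ> deriv_t j"
    have "act M ?P (place \<mu> v) = place (\<mu> + ?l) v" for v
      by (rule weight_eqI) (auto simp: act_mult_deriv[OF M j] at_weight_place algebra_simps)
    then have "e (place (\<mu> + ?l) v) = act M ?P (e (place \<mu> v))" if "\<forall>r. v r \<in> rep_space M" for v
      using rep_hom_act[OF e mult_deriv_in_centralizer, of "place \<mu> v" i0 j]
        place_in_lattice_space[OF M \<mu>] that by simp
    moreover have "act M ?P u = 0 \<longleftrightarrow> u = 0" for u
    proof
      assume zero: "act M ?P u = 0"
      show "u = 0"
      proof (rule weight_eqI)
        fix \<nu> r
        show "at_weight \<nu> u r = at_weight \<nu> 0 r"
          using act_mult_deriv[OF M j, of "\<nu> + ?l" u r] by (simp add: zero)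
      qed
    next
      assume "u = 0"
      then have "at_weight \<nu> (act M ?P u) r = at_weight \<nu> 0 r" for \<nu> r
        by (simp add: act_mult_deriv[OF M j])
      then show "act M ?P u = 0"
        by (rule weight_eqI)
    qed
    ultimately show ?thesis
      by simp
  qed
  have D: "e (place \<mu> v) = 0"
    if "(\<Sum>i\<in>UNIV. \<mu> $ i) = a" "\<And>r. v r \<in> rep_space M" for \<mu> v
    using weight_induct[of ?D, OF D_base D_step that(1)] that(2) by simp
  let ?W = "{\<mu>. \<exists>r. at_weight \<mu> w r \<noteq> 0}"
  have \<mu>: "(\<Sum>i\<in>UNIV. \<mu> $ i) = a" if "\<mu> \<in> ?W" for \<mu>
    using that lattice_spaceD(2)[OF w] by blast
  have "e w = e (\<Sum>\<mu>\<in>?W. place \<mu> (at_weight \<mu> w))"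
    using place_sum[of w] by simp
  also have "\<dots> = (\<Sum>\<mu>\<in>?W. e (place \<mu> (at_weight \<mu> w)))"
    using place_in_lattice_space[OF M \<mu> lattice_spaceD(1)[OF w]]
    by (intro rep_hom_sum[OF e subspace_rep]) simp
  also have "\<dots> = 0"
    by (intro sum.neutral ballI D[OF \<mu> lattice_spaceD(1)[OF w]])
  finally show ?thesis .
qed

end

section \<open>Direct summands and their traces on the bottom layer\<close>

context
  fixes M :: "bool rep" and S T
  assumes M: "M \<in> free2_fd_modules"
    and S: "subrep weyl_centralizer S (lattice_rep M)"
    and T: "subrep weyl_centralizer T (lattice_rep M)"
    and disjoint: "S \<inter> T = {0}"
    and total: "{u + w |u w. u \<in> S \<and> w \<in> T} = rep_space (lattice_rep M)"
begin

lemma summand_projection: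
  obtains e where "e \<in> rep_hom weyl_centralizer (lattice_rep M) (lattice_rep M)"
    "\<And>w. w \<in> lattice_space M \<Longrightarrow> e w \<in> S" "\<And>w. w \<in> lattice_space M \<Longrightarrow> w - e w \<in> T"
    "\<And>w. w \<in> S \<Longrightarrow> e w = w" "\<And>w. w \<in> T \<Longrightarrow> e w = 0"
proof -
  have subS: "cvs.subspace S" "S \<subseteq> lattice_space M"
    and subT: "cvs.subspace T" "T \<subseteq> lattice_space M"
    using S T by (auto simp: subrep_def)
  have "\<exists>u. u \<in> S \<and> w - u \<in> T" if w: "w \<in> lattice_space M" for w
  proof -
    have "w \<in> {u + w |u w. u \<in> S \<and> w \<in> T}"
      using w by (simp only: total rep_sel)
    then obtain u t where "w = u + t" "u \<in> S" "t \<in> T"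
      by blast
    then show ?thesis
      by (intro exI[of _ u]) simp
  qed
  then obtain p where p: "\<And>w. w \<in> lattice_space M \<Longrightarrow> p w \<in> S"
    "\<And>w. w \<in> lattice_space M \<Longrightarrow> w - p w \<in> T"
    by metis
  \<comment> \<open>All laws of a morphism follow from this: it suffices to exhibit an element of
    \<open>S\<close> whose difference from the argument lies in \<open>T\<close>.\<close>
  have unique: "p w = u" if "w \<in> lattice_space M" "u \<in> S" "w - u \<in> T" for w u
  proof -
    have "p w - u \<in> S"
      by (rule subspace_closed(4)[OF subS(1) p(1)[OF that(1)] that(2)])
    moreover have "(w - u) - (w - p w) \<in> T"
      by (rule subspace_closed(4)[OF subT(1) that(3) p(2)[OF that(1)]])
    ultimately have "p w - u \<in> S \<inter> T"
      by simp
    then show ?thesis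
      by (simp add: disjoint)
  qed
  define e where "e = (\<lambda>w\<in>lattice_space M. p w)"
  have "e \<in> rep_hom weyl_centralizer (lattice_rep M) (lattice_rep M)"
  proof (rule rep_homI, unfold rep_sel)
    show "e \<in> extensional (lattice_space M)"
      by (simp add: e_def)
    fix v w
    assume v: "v \<in> lattice_space M"
    show "e v \<in> lattice_space M"
      using p(1)[OF v] subS(2) v by (auto simp: e_def)
    show "e (cscale c v) = cscale c (e v)" for c
    proof -
      have "cscale c v - cscale c (p v) \<in> T"
        using subspace_closed(3)[OF subT(1) p(2)[OF v]] by (simp add: cvs.scale_right_diff_distrib)
      then show ?thesis
        using v subspace_closed(3)[OF subspace_lattice_space[OF M] v]
          subspace_closed(3)[OF subS(1) p(1)[OF v]]
        by (simp add: e_def unique)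
    qed
    show "e (act M P v) = act M P (e v)" if P: "P \<in> weyl_centralizer" for P
    proof -
      have hom: "linear_between (lattice_space M) (lattice_space M) (act M P)"
        using operator_module_lattice_rep[OF M] P by (simp add: operator_module_def)
      have "act M P ((v - p v) + p v) = act M P (v - p v) + act M P (p v)"
        using hom p[OF v] subS(2) subT(2) unfolding linear_between_def by blast
      then have "act M P v - act M P (p v) = act M P (v - p v)"
        by simp
      then have "act M P v - act M P (p v) \<in> T"
        using T P p(2)[OF v] by (simp add: subrep_def)
      moreover have "act M P (p v) \<in> S"
        using S P p(1)[OF v] by (simp add: subrep_def)
      ultimately show ?thesis
        using v act_closed[OF M P v] by (simp add: e_def unique)
    qed
    assume w: "w \<in> lattice_space M"
    have "(v + w) - (p v + p w) \<in> T"
      using subspace_closed(2)[OF subT(1) p(2)[OF v] p(2)[OF w]] by (simp add: algebra_simps)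
    then have "p (v + w) = p v + p w"
      by (rule unique[OF subspace_closed(2)[OF subspace_lattice_space[OF M] v w]
            subspace_closed(2)[OF subS(1) p(1)[OF v] p(1)[OF w]]])
    then show "e (v + w) = e v + e w"
      using v w subspace_closed(2)[OF subspace_lattice_space[OF M] v w] by (simp add: e_def)
  qed
  moreover have "e w = w" if "w \<in> S" for w
    using that subS(2) subspace_closed(1)[OF subT(1)] by (auto simp: e_def intro!: unique)
  moreover have "e w = 0" if "w \<in> T" for w
    using that subT(2) subspace_closed(1)[OF subS(1)] by (auto simp: e_def intro!: unique)
  ultimately show thesis
    using p by (intro that[of e]) (simp_all add: e_def)
qed

text \<open>The projection onto \<open>S\<close> sends each tail to a tail in \<open>S\<close>. If
  \<open>S\<close> has only the zero tail, the projection vanishes on the bottom layer, hence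
  altogether.\<close>

lemma summand_zero:
  assumes zero: "{x \<in> rep_space M. tail x \<in> S} = {0}"
  shows "S = {0}"
proof -
  obtain e where e: "e \<in> rep_hom weyl_centralizer (lattice_rep M) (lattice_rep M)"
    and eS: "\<And>w. w \<in> lattice_space M \<Longrightarrow> e w \<in> S" "\<And>w. w \<in> S \<Longrightarrow> e w = w"
    using summand_projection by metis
  have "e (tail x) = 0" if x: "x \<in> rep_space M" for x
  proof -
    have "tail (corner e x) \<in> S"
      using eS(1)[OF tail_in[OF M x]] hom_tail(1)[OF M M e x] by simp
    then have "corner e x \<in> {x \<in> rep_space M. tail x \<in> S}"
      using hom_tail(2)[OF M M e x] by simp
    then show ?thesis
      unfolding zero using hom_tail(1)[OF M M e x] by (simp add: tail_linear)
  qed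
  then have "e w = 0" if "w \<in> lattice_space M" for w
    using idempotent_hom_zero[OF M e] eS that by blast
  moreover have "S \<subseteq> lattice_space M"
    using S by (simp add: subrep_def)
  ultimately have "w = 0" if "w \<in> S" for w
    using eS(2)[OF that] that by auto
  then show ?thesis
    using disjoint by blast
qed

text \<open>The two traces are the image and the kernel of the idempotent \<open>corner e\<close>,
  where \<open>e\<close> projects onto \<open>S\<close> along \<open>T\<close>. On the bottom layer
  \<open>X\<close> and \<open>Y\<close> are zero, so stability under the generators is not visible
  there; it comes from \<open>corner e\<close> commuting with them.\<close>

lemma tail_summands:
  shows "subrep UNIV {x \<in> rep_space M. tail x \<in> S} M"
    and "subrep UNIV {x \<in> rep_space M. tail x \<in> T} M"
    and "{x \<in> rep_space M. tail x \<in> S} \<inter> {x \<in> rep_space M. tail x \<in> T} = {0}"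
    and "{x + y |x y. x \<in> {x \<in> rep_space M. tail x \<in> S}
           \<and> y \<in> {x \<in> rep_space M. tail x \<in> T}} = rep_space M"
proof -
  obtain e where e: "e \<in> rep_hom weyl_centralizer (lattice_rep M) (lattice_rep M)"
    and eS: "\<And>w. w \<in> lattice_space M \<Longrightarrow> e w \<in> S" "\<And>w. w \<in> S \<Longrightarrow> e w = w"
    and eT: "\<And>w. w \<in> lattice_space M \<Longrightarrow> w - e w \<in> T" "\<And>w. w \<in> T \<Longrightarrow> e w = 0"
    using summand_projection by metis
  note tail = hom_tail[OF M M e]
  note closed = subspace_closed[OF free2_subspace[OF M]]
  have subS: "cvs.subspace S" and subT: "cvs.subspace T"
    using S T by (simp_all add: subrep_def)
  have tail_sub: "cvs.subspace {x \<in> rep_space M. tail x \<in> R}" if "cvs.subspace R" for R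
    using closed subspace_closed[OF that] by (auto simp: cvs.subspace_def tail_linear)
  show "subrep UNIV {x \<in> rep_space M. tail x \<in> S} M"
    unfolding subrep_def
  proof (intro conjI tail_sub subS ballI)
    fix b x
    assume "x \<in> {x \<in> rep_space M. tail x \<in> S}"
    then have x: "x \<in> rep_space M" "tail x \<in> S"
      by auto
    have "tail (corner e x) = tail x"
      using tail(1)[OF x(1)] eS(2)[OF x(2)] by simp
    then have "corner e x = x"
      by (simp only: tail_inject)
    then have "e (tail (rep_act M b x)) = tail (rep_act M b x)"
      using tail(1)[OF free2_closed[OF M x(1)]] tail(3)[OF x(1)] by simp
    then have "tail (rep_act M b x) \<in> S"
      using eS(1)[OF tail_in[OF M free2_closed[OF M x(1)]]] by metis
    then show "rep_act M b x \<in> {x \<in> rep_space M. tail x \<in> S}"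
      using free2_closed[OF M x(1)] by simp
  qed auto
  show "subrep UNIV {x \<in> rep_space M. tail x \<in> T} M"
    unfolding subrep_def
  proof (intro conjI tail_sub subT ballI)
    fix b x
    assume "x \<in> {x \<in> rep_space M. tail x \<in> T}"
    then have x: "x \<in> rep_space M" "tail x \<in> T"
      by auto
    have "tail (corner e x) = tail 0"
      using tail(1)[OF x(1)] eT(2)[OF x(2)] by (simp add: tail_linear)
    then have "corner e x = 0"
      by (simp only: tail_inject)
    then have "e (tail (rep_act M b x)) = 0"
      using tail(1)[OF free2_closed[OF M x(1)]] tail(3)[OF x(1)] free2_zero[OF M]
      by (simp add: tail_linear)
    then have "tail (rep_act M b x) \<in> T"
      using eT(1)[OF tail_in[OF M free2_closed[OF M x(1)]]] by (metis diff_zero)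
    then show "rep_act M b x \<in> {x \<in> rep_space M. tail x \<in> T}"
      using free2_closed[OF M x(1)] by simp
  qed auto
  have "x = 0" if "tail x \<in> S" "tail x \<in> T" for x
  proof -
    have "tail x = tail 0"
      using that disjoint by (auto simp: tail_linear)
    then show ?thesis
      by (simp only: tail_inject)
  qed
  then show "{x \<in> rep_space M. tail x \<in> S} \<inter> {x \<in> rep_space M. tail x \<in> T} = {0}"
    using closed(1) subspace_closed(1)[OF subS] subspace_closed(1)[OF subT]
    by (auto simp: tail_linear)
  show "{x + y |x y. x \<in> {x \<in> rep_space M. tail x \<in> S}
           \<and> y \<in> {x \<in> rep_space M. tail x \<in> T}} = rep_space M"
  proof (intro subset_antisym subsetI)
    fix x
    assume x: "x \<in> rep_space M"
    have "tail (corner e x) \<in> S" "tail (x - corner e x) \<in> T"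
      using eS(1)[OF tail_in[OF M x]] eT(1)[OF tail_in[OF M x]] tail(1)[OF x]
      by (simp_all add: tail_linear)
    moreover have "corner e x \<in> rep_space M" "x - corner e x \<in> rep_space M"
      using closed(4)[OF x tail(2)[OF x]] tail(2)[OF x] by simp_all
    moreover have "x = corner e x + (x - corner e x)"
      by simp
    ultimately show "x \<in> {x + y |x y. x \<in> {x \<in> rep_space M. tail x \<in> S}
           \<and> y \<in> {x \<in> rep_space M. tail x \<in> T}}"
      by blast
  qed (use closed(2) in auto)
qed

end

lemma indecomposable_lattice_rep:
  assumes M: "M \<in> free2_fd_modules" and indec: "indecomposable UNIV M"
  shows "indecomposable weyl_centralizer (lattice_rep M)"
  unfolding indecomposable_def
proof (intro conjI allI impI)
  obtain x where x: "x \<in> rep_space M" "x \<noteq> 0"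
    using indec zero_in[OF M] by (auto simp: indecomposable_def)
  have "tail x \<noteq> 0"
    using x(2) tail_inject[of x 0] by (simp add: tail_linear)
  then show "rep_space (lattice_rep M) \<noteq> {0}"
    using tail_in[OF M x(1)] by auto
next
  fix S T
  assume "subrep weyl_centralizer S (lattice_rep M) \<and> subrep weyl_centralizer T (lattice_rep M)
    \<and> S \<inter> T = {0} \<and> {u + w |u w. u \<in> S \<and> w \<in> T} = rep_space (lattice_rep M)"
  then have S: "subrep weyl_centralizer S (lattice_rep M)"
    and T: "subrep weyl_centralizer T (lattice_rep M)" and ST: "S \<inter> T = {0}"
    and total: "{u + w |u w. u \<in> S \<and> w \<in> T} = rep_space (lattice_rep M)"
    by simp_all
  have TS: "T \<inter> S = {0}"
    using ST by blast
  have "{u + w |u w. u \<in> T \<and> w \<in> S} = {u + w |u w. u \<in> S \<and> w \<in> T}"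
    by (rule Collect_cong) (metis add.commute)
  then have total': "{u + w |u w. u \<in> T \<and> w \<in> S} = rep_space (lattice_rep M)"
    using total by simp
  \<comment> \<open>A decomposition of the constructed module induces one of \<open>M\<close>, so
    one trace is zero; \<open>summand_zero\<close>, used with the summands in either order, then
    removes the whole summand.\<close>
  have "{x \<in> rep_space M. tail x \<in> S} = {0} \<or> {x \<in> rep_space M. tail x \<in> T} = {0}"
    using indec tail_summands[OF M S T ST total] unfolding indecomposable_def by blast
  then show "S = {0} \<or> T = {0}"
    using summand_zero[OF M S T ST total] summand_zero[OF M T S TS total'] by blast
qed

lemma representation_embedding_lattice:
  "representation_embedding UNIV free2_fd_modules weyl_centralizer (bDEH_0 (of_int a))
     lattice_rep (\<lambda>M N. lattice_map M)"
proof
  fix X Y Z :: "bool rep" and f g :: "vec \<Rightarrow> vec" and c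
  assume X: "X \<in> free2_fd_modules"
  show "lattice_rep X \<in> bDEH_0 (of_int a)"
    by (rule lattice_rep_in_bDEH_0[OF X])
  show "lattice_map X (\<lambda>x\<in>rep_space X. x) = (\<lambda>x\<in>rep_space (lattice_rep X). x)"
    by (simp add: lattice_map_ident[OF X])
  show "indecomposable UNIV X \<Longrightarrow> indecomposable weyl_centralizer (lattice_rep X)"
    by (rule indecomposable_lattice_rep[OF X])
  assume Y: "Y \<in> free2_fd_modules"
  show "rep_isomorphic weyl_centralizer (lattice_rep X) (lattice_rep Y) \<Longrightarrow>
      rep_isomorphic UNIV X Y"
    by (rule lattice_rep_reflects_iso[OF X Y])
  {
    assume f: "f \<in> rep_hom UNIV X Y"
    show "lattice_map X f \<in> rep_hom weyl_centralizer (lattice_rep X) (lattice_rep Y)"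
      by (rule lattice_map_hom[OF X Y f])
    show "lattice_map X (\<lambda>x\<in>rep_space X. cscale c (f x))
        = (\<lambda>x\<in>rep_space (lattice_rep X). cscale c (lattice_map X f x))"
      by (simp add: lattice_map_scale[OF X f])
    {
      assume "g \<in> rep_hom UNIV X Y"
      then show "lattice_map X (\<lambda>x\<in>rep_space X. f x + g x)
          = (\<lambda>x\<in>rep_space (lattice_rep X). lattice_map X f x + lattice_map X g x)"
        by (simp add: lattice_map_add[OF X Y f])
    }
    {
      assume "Z \<in> free2_fd_modules" and "g \<in> rep_hom UNIV Y Z"
      then show "lattice_map X (compose (rep_space X) g f)
          = compose (rep_space (lattice_rep X)) (lattice_map Y g) (lattice_map X f)"
        by (simp add: lattice_map_compose[OF X Y f])
    }
  }
  {
    assume "Z \<in> free2_fd_modules" and "short_exact UNIV X Y Z f g"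
    then show "short_exact weyl_centralizer (lattice_rep X) (lattice_rep Y) (lattice_rep Z)
        (lattice_map X f) (lattice_map Y g)"
      by (rule lattice_map_exact[OF X Y])
  }
qed

end

theorem corollary6p8:
  fixes n :: nat and a :: int
  assumes "n \<ge> 1"
    and "CARD('i::finite) = n + 1"
  shows "wild (weyl_centralizer :: 'i operator set) (bDEH_0 (of_int a))"
proof -
  \<comment> \<open>Two different indices are required to carry \<open>X\<close> and
    \<open>Y\<close>; \<open>n \<ge> 1\<close> supplies them.\<close>
  have "\<not> is_singleton (UNIV :: 'i set)"
    using assms by (simp add: is_singleton_altdef)
  then obtain i0 i1 :: 'i where "i0 \<noteq> i1"
    by (metis UNIV_I UNIV_eq_I is_singletonI' empty_not_UNIV)
  then interpret lattice_functor i0 i1 a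
    by unfold_locales
  show ?thesis
    unfolding wild_def using representation_embedding_lattice by blast
qed

end
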